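(* Let $G$ be a unimodular, compactly generated locally compact group, let $H$ be a closed subgroup of $G$ which is unimodular and compactly generated, and let $1\leq p\leq\infty$. Then $$j_{G,p}\preceq j_{H,p}.$$ Moreover, if $H$ is not distorted in $G$, then $$J^b_{G,p}\preceq J^b_{H,p}.$$
   Context: For a locally compact, compactly generated group $G$ with left Haar measure $\mu$, fix a compact symmetric generating subset $S$ (i.e. $\bigcup_{n}S^n=G$) and the left-invariant word metric $d_S(g,h)=\inf\{n: g^{-1}h\in S^n\}$. $B(1,r)$ is the closed ball of radius $r$ around the neutral element. Let $(\lambda(g)f)(x)=f(g^{-1}x)$. For $1\le p\le\infty$ and a measurable subset $A\subset G$ put $$J_p(A)=\sup_{f}\frac{\|f\|_p}{\sup_{s\in S}\|f-\lambda(s)f\|_p}\in[0,\infty],$$ the supremum being over nonzero $f\in L^p(G)$ supported in $A$. The $L^p$-isoperimetric profile is $j_{G,p}(v)=\sup_{\mu(A)\le v}J_p(A)$, and the $L^p$-isoperimetric profile inside balls is $J^b_{G,p}(r)=J_p(B(1,r))$. The profiles of $H$ are defined in the same way, using a Haar measure and a compact symmetric generating set of $H$; the asymptotic behaviour does not depend on these choices. For monotone functions $f,g$ on $\mathbb{R}_+$ write $f\preceq g$ if there is $C>0$ such that $f(t)=O(g(Ct))$ as $t\to\infty$. $H$ is not distorted in $G$ if the inclusion $H\to G$ is a quasi-isometric embedding for the word metrics of $H$ and $G$ associated with compact generating sets. *)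

theory Defs
  imports "HOL-Probability.Essential_Supremum"
begin

text \<open>
  Groups are written additively, following the class \<^class>\<open>group_add\<close>, which does not assume
  commutativity: \<open>0\<close> is the neutral element, \<open>g + h\<close> the product and \<open>- g\<close> the inverse.
  Everything below is relative to a subset \<open>K\<close> of an ambient topological group, so that it
  applies to the whole group (\<open>K = UNIV\<close>) and to a closed subgroup with its subspace topology.
\<close>

definition is_subgroup :: "'a::group_add set \<Rightarrow> bool" where
  "is_subgroup K \<longleftrightarrow> 0 \<in> K \<and> (\<forall>x\<in>K. \<forall>y\<in>K. x + y \<in> K) \<and> (\<forall>x\<in>K. - x \<in> K)"


section \<open>Haar measures and unimodularity\<close>

definition left_haar_measure :: "'a::topological_group_add set \<Rightarrow> 'a measure \<Rightarrow> bool" where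
  "left_haar_measure K \<mu> \<longleftrightarrow>
     sets \<mu> = sets (restrict_space borel K) \<and>
     emeasure \<mu> K \<noteq> 0 \<and>
     (\<forall>C. C \<subseteq> K \<and> compact C \<longrightarrow> emeasure \<mu> C < \<infinity>) \<and>
     (\<forall>A\<in>sets \<mu>. emeasure \<mu> A = (INF U\<in>{U. openin (top_of_set K) U \<and> A \<subseteq> U}. emeasure \<mu> U)) \<and>
     (\<forall>U. openin (top_of_set K) U \<longrightarrow>
        emeasure \<mu> U = (SUP C\<in>{C. compact C \<and> C \<subseteq> U}. emeasure \<mu> C)) \<and>
     (\<forall>g\<in>K. \<forall>A\<in>sets \<mu>. emeasure \<mu> ((\<lambda>x. g + x) ` A) = emeasure \<mu> A)"

definition unimodular :: "'a::topological_group_add set \<Rightarrow> bool" where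
  "unimodular K \<longleftrightarrow>
     (\<forall>\<mu>. left_haar_measure K \<mu> \<longrightarrow>
        (\<forall>g\<in>K. \<forall>A\<in>sets \<mu>. emeasure \<mu> ((\<lambda>x. x + g) ` A) = emeasure \<mu> A))"


section \<open>Generating sets and word metrics\<close>

primrec set_power :: "'a::group_add set \<Rightarrow> nat \<Rightarrow> 'a set" where
  "set_power S 0 = {0}"
| "set_power S (Suc n) = {s + x | s x. s \<in> S \<and> x \<in> set_power S n}"

definition compact_symmetric_generating :: "'a::topological_group_add set \<Rightarrow> 'a set \<Rightarrow> bool" where
  "compact_symmetric_generating K S \<longleftrightarrow>
     compact S \<and> uminus ` S = S \<and> (\<Union>n. set_power S n) = K"

text \<open>The infimum is taken over a nonempty set of naturals when \<open>g\<close> and \<open>h\<close> lie in the subgroup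
  generated by \<open>S\<close>; it is meaningless otherwise.\<close>

definition word_dist :: "'a::group_add set \<Rightarrow> 'a \<Rightarrow> 'a \<Rightarrow> real" where
  "word_dist S g h = real (Inf {n. - g + h \<in> set_power S n})"

definition word_ball :: "'a::group_add set \<Rightarrow> 'a set \<Rightarrow> real \<Rightarrow> 'a set" where
  "word_ball K S r = {g \<in> K. word_dist S 0 g \<le> r}"

definition quasi_isometric_embedding ::
    "'a set \<Rightarrow> ('a \<Rightarrow> 'a \<Rightarrow> real) \<Rightarrow> ('b \<Rightarrow> 'b \<Rightarrow> real) \<Rightarrow> ('a \<Rightarrow> 'b) \<Rightarrow> bool" where
  "quasi_isometric_embedding X d d' \<phi> \<longleftrightarrow>
     (\<exists>L\<ge>1. \<exists>c\<ge>0. \<forall>x\<in>X. \<forall>y\<in>X.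
        d x y / L - c \<le> d' (\<phi> x) (\<phi> y) \<and> d' (\<phi> x) (\<phi> y) \<le> L * d x y + c)"

text \<open>\<open>H\<close> carries the word metric of \<open>T\<close>, the ambient group that of \<open>S\<close>.\<close>

definition undistorted :: "'a::group_add set \<Rightarrow> 'a set \<Rightarrow> 'a set \<Rightarrow> bool" where
  "undistorted H T S \<longleftrightarrow> quasi_isometric_embedding H (word_dist T) (word_dist S) (\<lambda>x. x)"


section \<open>Isoperimetric profiles\<close>

definition Lp_norm :: "'a measure \<Rightarrow> ennreal \<Rightarrow> ('a \<Rightarrow> real) \<Rightarrow> ennreal" where
  "Lp_norm \<mu> p f =
     (if p = \<infinity> then esssup \<mu> (\<lambda>x. ennreal \<bar>f x\<bar>)
      else let I = \<integral>\<^sup>+ x. ennreal (\<bar>f x\<bar> powr enn2real p) \<partial>\<mu>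
           in if I = \<infinity> then \<infinity> else ennreal (enn2real I powr (1 / enn2real p)))"

definition left_translate :: "'a::group_add \<Rightarrow> ('a \<Rightarrow> real) \<Rightarrow> 'a \<Rightarrow> real" where
  "left_translate g f = (\<lambda>x. f (- g + x))"

text \<open>Elements of \<open>L\<^sup>p\<close> are represented by measurable functions, so being nonzero and being
  supported in \<open>A\<close> are understood up to null sets. In \<^typ>\<open>ennreal\<close>, a positive number divided by
  \<open>0\<close> is \<open>\<infinity>\<close>, and the supremum of the empty set is \<open>0\<close>.\<close>

definition isop_J :: "'a::group_add measure \<Rightarrow> 'a set \<Rightarrow> ennreal \<Rightarrow> 'a set \<Rightarrow> ennreal" where
  "isop_J \<mu> S p A =
     (SUP f\<in>{f. f \<in> borel_measurable \<mu> \<and> Lp_norm \<mu> p f < \<infinity> \<and>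
                \<not> (AE x in \<mu>. f x = 0) \<and> (AE x in \<mu>. x \<notin> A \<longrightarrow> f x = 0)}.
        Lp_norm \<mu> p f / (SUP s\<in>S. Lp_norm \<mu> p (\<lambda>x. f x - left_translate s f x)))"

definition isop_profile :: "'a::group_add measure \<Rightarrow> 'a set \<Rightarrow> ennreal \<Rightarrow> real \<Rightarrow> ennreal" where
  "isop_profile \<mu> S p v = (SUP A\<in>{A \<in> sets \<mu>. emeasure \<mu> A \<le> ennreal v}. isop_J \<mu> S p A)"

definition isop_profile_balls ::
    "'a::group_add set \<Rightarrow> 'a measure \<Rightarrow> 'a set \<Rightarrow> ennreal \<Rightarrow> real \<Rightarrow> ennreal" where
  "isop_profile_balls K \<mu> S p r = isop_J \<mu> S p (word_ball K S r)"

text \<open>\<open>f(t) = O(g(C t))\<close> as \<open>t \<rightarrow> \<infinity>\<close>, spelled out because the profiles may take the value \<open>\<infinity>\<close>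
  (for instance for compact groups).\<close>

definition asymp_le :: "(real \<Rightarrow> ennreal) \<Rightarrow> (real \<Rightarrow> ennreal) \<Rightarrow> bool" (infix "\<preceq>" 50) where
  "f \<preceq> g \<longleftrightarrow> (\<exists>C>0. \<exists>M::real. M > 0 \<and> (\<forall>\<^sub>F t in at_top. f t \<le> ennreal M * g (C * t)))"

end

theory Submission
  imports Defs
begin

text \<open>Let \<open>j\<close> be the value of the profile of \<open>H\<close> at the relevant scale. The aim is an inequality
  \<open>\<parallel>f\<parallel> \<le> M * j * sup \<parallel>f - \<lambda>(s) f\<parallel>\<close> for functions \<open>f\<close> on \<open>G\<close>, where \<open>s\<close> ranges over \<open>S\<close>; this
  supremum is called the gradient of \<open>f\<close>.

  Cut \<open>f\<close> into its slices \<open>h \<mapsto> f (h + g)\<close> along the right cosets of \<open>H\<close>. If every slice is supported in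
  a set for which \<open>H\<close> has the constant \<open>j\<close>, its norm is at most \<open>j\<close> times its gradient. For \<open>p < \<infinity>\<close>
  the \<open>p\<close>-th power of the norm of \<open>f\<close> is the integral of those of the slices (\<open>disintegration\<close>, by
  means of a Bruhat function); for \<open>p = \<infinity>\<close> the same formula for null sets takes its place.
  A gradient is a supremum over \<open>T\<close> and does not commute with an integral over the cosets, so it
  is first dominated by an average over a compact set (\<open>sup_displacement_le_average\<close>). Finally a displacement by an element of a compact subset of \<open>H\<close>
  is dominated by the gradient on \<open>G\<close>, because word length is locally bounded. This gives
  \<open>coset_comparison\<close>, which contains all the analysis that involves both groups.

  It remains to control the supports of the slices. For balls this is immediate when \<open>H\<close> is
  undistorted: a coset meets a ball of \<open>G\<close> inside a right translate of a ball of \<open>H\<close> of comparable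
  radius. For sets \<open>A\<close> of measure at most \<open>v\<close> a slice may be much larger than \<open>v\<close>, if \<open>A\<close> is thin
  transversally to \<open>H\<close>. But where \<open>A\<close> is thin at unit scale, that is, where it fills at most half of a
  translate \<open>U + x\<close> of a fixed ball, a typical displacement leaves \<open>A\<close> and \<open>f\<close> is controlled
  by its gradient (\<open>thin_part_le_gradient\<close>). On the thick part, a slice of large measure contains many
  separated points, hence yields many disjoint half-filled translates of \<open>U\<close>; all have the
  measure of \<open>U\<close> by unimodularity of \<open>G\<close>, so there are only \<open>O(v)\<close> of them. As \<open>H\<close> is unimodular too, the
  slice is covered by as many translates of equal measure in \<open>H\<close> (\<open>thick_slice_measure_le\<close>).

  The group need not be second countable, and then Borel functions on \<open>G \<times> G\<close> are in general not
  measurable for the product of the Borel \<open>\<sigma>\<close>-algebras, as Tonelli's theorem requires. All the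
  integrals above are therefore taken for Baire functions: multiplication is measurable for them
  (\<open>measurable_action\<close>) and every Borel function agrees with one almost everywhere
  (\<open>borel_fun_baire_version\<close>).\<close>

section \<open>Word lengths and topology of compactly generated groups\<close>

lemma continuous_on_translate_left:
  fixes a :: "'a::topological_group_add"
  shows "continuous_on A (\<lambda>x. a + x)"
  by (intro continuous_intros)

lemma continuous_on_translate_right:
  fixes a :: "'a::topological_group_add"
  shows "continuous_on A (\<lambda>x. x + a)"
  by (intro continuous_intros)

lemma vimage_add_left: "(\<lambda>x. a + x) -` A = (\<lambda>x. - a + x) ` A" for a :: "'a::group_add"
  by (force simp: image_iff add.assoc[symmetric])

lemma vimage_add_right: "(\<lambda>x. x + a) -` A = (\<lambda>x. x + - a) ` A" for a :: "'a::group_add"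
  by (force simp: image_iff)

lemma open_translate_left:
  fixes a :: "'a::topological_group_add"
  assumes "open U" shows "open ((\<lambda>x. a + x) ` U)"
  using open_vimage[OF assms continuous_on_translate_left[of UNIV "- a"]] 
  by (simp add: vimage_add_left)

lemma open_translate_right:
  fixes a :: "'a::topological_group_add"
  assumes "open U" shows "open ((\<lambda>x. x + a) ` U)"
  using open_vimage[OF assms continuous_on_translate_right[of UNIV "- a"]]
  unfolding vimage_add_right by simp

lemma compact_set_sum:
  fixes A B :: "'a::topological_group_add set"
  assumes "compact A" "compact B"
  shows "compact {a + b | a b. a \<in> A \<and> b \<in> B}"
proof -
  have "{a + b | a b. a \<in> A \<and> b \<in> B} = (\<lambda>(a, b). a + b) ` (A \<times> B)"
    by force
  moreover have "compact ((\<lambda>(a, b). a + b) ` (A \<times> B))"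
    by (intro compact_continuous_image compact_Times assms)
       (auto simp: case_prod_beta intro!: continuous_intros)
  ultimately show ?thesis
    by simp
qed

lemma compact_set_power:
  fixes S :: "'a::topological_group_add set"
  assumes "compact S" shows "compact (set_power S n)"
  by (induction n) (simp_all add: compact_set_sum assms)

lemma set_power_add:
  "x \<in> set_power S m \<Longrightarrow> y \<in> set_power S n \<Longrightarrow> x + y \<in> set_power S (m + n)"
  by (induction m arbitrary: x) (auto simp: add.assoc, blast)

lemma set_power_uminus:
  assumes "uminus ` S = S"
  shows "x \<in> set_power S n \<Longrightarrow> - x \<in> set_power S n"
proof (induction n arbitrary: x)
  case (Suc n)
  then obtain s y where sy: "x = s + y" "s \<in> S" "y \<in> set_power S n"
    by auto
  have "- s + 0 \<in> set_power S (Suc 0)"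
    using sy(2) assms by (auto intro!: exI[of _ "- s"])
  then have "- y + (- s + 0) \<in> set_power S (n + Suc 0)"
    using Suc.IH[OF sy(3)] by (rule set_power_add[rotated])
  then show ?case
    by (simp add: sy(1) minus_add)
qed simp

lemma word_ball_eq:
  assumes "(\<Union>n. set_power S n) = K"
  shows "word_ball K S r = (\<Union>n\<in>{n. real n \<le> r}. set_power S n)"
proof (intro equalityI subsetI)
  fix x assume x: "x \<in> word_ball K S r"
  then have "{n. x \<in> set_power S n} \<noteq> {}"
    using assms by (auto simp: word_ball_def)
  from Inf_nat_def1[OF this] x
  show "x \<in> (\<Union>n\<in>{n. real n \<le> r}. set_power S n)"
    by (auto simp: word_ball_def word_dist_def)
next
  fix x assume "x \<in> (\<Union>n\<in>{n. real n \<le> r}. set_power S n)"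
  then obtain n where n: "real n \<le> r" "x \<in> set_power S n"
    by auto
  then have "Inf {n. x \<in> set_power S n} \<le> n"
    by (intro cInf_lower) auto
  then show "x \<in> word_ball K S r"
    using n assms by (auto simp: word_ball_def word_dist_def)
qed

locale compactly_generated_group =
  fixes S :: "'a::{topological_group_add, t2_space} set"
  assumes locally_compact: "locally_compact_space (euclidean :: 'a topology)"
    and generating: "compact_symmetric_generating UNIV S"
begin

lemma compact_S: "compact S" and uminus_S: "uminus ` S = S"
  and Union_set_power: "(\<Union>n. set_power S n) = UNIV"
  using generating by (auto simp: compact_symmetric_generating_def)

lemma ex_set_power: "\<exists>n. x \<in> set_power S n"
  using Union_set_power by auto

lemma hausdorff: "Hausdorff_space (euclidean :: 'a topology)"
  unfolding Hausdorff_space_def disjnt_def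
  by (metis hausdorff open_openin)

lemma completely_regular: "completely_regular_space (euclidean :: 'a topology)"
  using locally_compact hausdorff locally_compact_regular_imp_completely_regular_space by blast

lemma compact_neighbourhood:
  fixes K :: "'a set"
  assumes "compact K"
  obtains U L where "open U" "compact L" "K \<subseteq> U" "U \<subseteq> L"
proof -
  have "\<exists>U L. openin euclidean U \<and> compactin euclidean L \<and> closedin euclidean L \<and> K \<subseteq> U \<and> U \<subseteq> L"
    using locally_compact hausdorff assms
    by (metis locally_compact_space_compact_closed_compact compactin_euclidean_iff)
  then show ?thesis
    using that by auto
qed

text \<open>Some ball has an interior point by Baire's theorem, hence twice its radius gives a
  neighbourhood of the neutral element; its translates make the word length locally bounded.\<close>

lemma ball_contains_neighbourhood:
  obtains O' n where "open O'" "0 \<in> O'" "O' \<subseteq> set_power S n"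
proof -
  let ?G = "range (set_power S)"
  have "\<exists>T\<in>?G. euclidean interior_of T \<noteq> {}"
  proof (rule ccontr)
    assume "\<not> ?thesis"
    then have "(euclidean :: 'a topology) interior_of (\<Union> ?G) = {}"
      using locally_compact hausdorff locally_compact_Hausdorff_imp_regular_space
      by (intro Baire_category_alt) (auto intro: compact_imp_closed compact_set_power compact_S)
    then show False
      using Union_set_power interior_of_topspace[of "euclidean :: 'a topology"] by simp
  qed
  then obtain n a where "a \<in> interior (set_power S n)"
    by (auto simp: Elementary_Topology.interior_def interior_of_def)
  then obtain O1 where O1: "open O1" "a \<in> O1" "O1 \<subseteq> set_power S n"
    by (auto simp: Elementary_Topology.interior_def)
  show ?thesis
  proof
    show "open ((\<lambda>x. x + - a) ` O1)"
      by (rule open_translate_right[OF O1(1)])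
    show "0 \<in> (\<lambda>x. x + - a) ` O1"
      using O1(2) by force
    show "(\<lambda>x. x + - a) ` O1 \<subseteq> set_power S (n + n)"
      using O1 by (auto simp del: add_uminus_conv_diff intro!: set_power_add set_power_uminus uminus_S)
  qed
qed

lemma compact_subset_balls:
  assumes "compact Q"
  obtains N where "Q \<subseteq> (\<Union>n\<le>N. set_power S n)"
proof -
  obtain O' m where O': "open O'" "0 \<in> O'" "O' \<subseteq> set_power S m"
    by (rule ball_contains_neighbourhood)
  have "\<forall>x. \<exists>n. x \<in> set_power S n"
    using ex_set_power by simp
  then obtain l where l: "\<And>x. x \<in> set_power S (l x)"
    by metis
  obtain D where D: "D \<subseteq> Q" "finite D" "Q \<subseteq> (\<Union>c\<in>D. (\<lambda>y. c + y) ` O')"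
  proof (rule compactE_image[OF assms, of Q "\<lambda>x. (\<lambda>y. x + y) ` O'"])
    show "Q \<subseteq> (\<Union>c\<in>Q. (\<lambda>y. c + y) ` O')"
      using O'(2) by force
  qed (auto intro: open_translate_left O'(1))
  show ?thesis
  proof
    show "Q \<subseteq> (\<Union>n\<le>Max (l ` D) + m. set_power S n)"
    proof
      fix x assume "x \<in> Q"
      then obtain c y where cy: "c \<in> D" "y \<in> O'" "x = c + y"
        using D(3) by auto
      then have "x \<in> set_power S (l c + m)"
        using l O'(3) by (auto intro: set_power_add)
      moreover have "l c \<le> Max (l ` D)"
        using cy(1) D(2) by auto
      ultimately show "x \<in> (\<Union>n\<le>Max (l ` D) + m. set_power S n)"
        by auto
    qed
  qed
qed

text \<open>A \<open>\<sigma>\<close>-compact space has the Lindeloef property. Right translates are the ones that fit the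
  uniform continuity used for \<open>measurable_action\<close>.\<close>

lemma countable_cover_translates:
  fixes V :: "'a set"
  assumes "open V" "0 \<in> V"
  obtains a :: "nat \<Rightarrow> 'a" where "(\<Union>i. (\<lambda>v. v + a i) ` V) = UNIV"
proof -
  have "\<exists>D. finite D \<and> set_power S n \<subseteq> (\<Union>c\<in>D. (\<lambda>v. v + c) ` V)" for n
  proof -
    obtain D where D: "D \<subseteq> set_power S n" "finite D" "set_power S n \<subseteq> (\<Union>c\<in>D. (\<lambda>y. y + c) ` V)"
    proof (rule compactE_image[OF compact_set_power[OF compact_S], of "set_power S n" "\<lambda>x. (\<lambda>y. y + x) ` V"])
      show "set_power S n \<subseteq> (\<Union>c\<in>set_power S n. (\<lambda>y. y + c) ` V)"
        using assms(2) by force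
    qed (auto intro: open_translate_right assms(1))
    then show ?thesis by auto
  qed
  then obtain D where D: "\<And>n. finite (D n)" "\<And>n. set_power S n \<subseteq> (\<Union>c\<in>D n. (\<lambda>v. v + c) ` V)"
    by metis
  define C where "C = insert 0 (\<Union>n. D n)"
  have C: "countable C" "C \<noteq> {}"
    using D(1) by (auto simp: C_def countable_finite)
  show ?thesis
  proof
    have "x \<in> (\<Union>i. (\<lambda>v. v + from_nat_into C i) ` V)" for x
    proof -
      obtain n where "x \<in> set_power S n"
        using ex_set_power by blast
      then obtain c where c: "c \<in> C" "x \<in> (\<lambda>v. v + c) ` V"
        using D(2)[of n] unfolding C_def by blast
      then obtain i where "from_nat_into C i = c"
        using C by (meson from_nat_into_surj)
      then show ?thesis
        using c by auto
    qed
    then show "(\<Union>i. (\<lambda>v. v + from_nat_into C i) ` V) = UNIV"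
      by auto
  qed
qed

end

section \<open>Baire sets and the measurability of the action\<close>

definition compact_support_continuous :: "('a::topological_space \<Rightarrow> real) \<Rightarrow> bool" where
  "compact_support_continuous F \<longleftrightarrow> continuous_on UNIV F \<and> (\<exists>K. compact K \<and> (\<forall>x. x \<notin> K \<longrightarrow> F x = 0))"

text \<open>The coarsest \<open>\<sigma>\<close>-algebra making continuous functions of compact support measurable; it can
  be strictly smaller than the Borel one.\<close>

definition baire :: "'a::topological_space measure" where
  "baire = sigma UNIV {F -` B | F B. compact_support_continuous F \<and> B \<in> sets borel}"

lemma space_baire [simp]: "space baire = UNIV"
  by (simp add: baire_def)

lemma measurable_baire_fun:
  "compact_support_continuous F \<Longrightarrow> F \<in> borel_measurable baire"
  unfolding baire_def by (intro measurableI) (auto intro!: sigma_sets.Basic)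

lemma measurable_into_baire:
  fixes h :: "'b \<Rightarrow> 'a::topological_space"
  assumes "\<And>F :: 'a \<Rightarrow> real. compact_support_continuous F \<Longrightarrow> (\<lambda>x. F (h x)) \<in> borel_measurable M"
  shows "h \<in> M \<rightarrow>\<^sub>M baire"
  unfolding baire_def
proof (rule measurable_sigma_sets)
  fix A :: "'a set" assume "A \<in> {F -` B | F B. compact_support_continuous F \<and> B \<in> sets borel}"
  then obtain F :: "'a \<Rightarrow> real" and B where FB: "A = F -` B" "compact_support_continuous F" "B \<in> sets borel"
    by auto
  have "(\<lambda>x. F (h x)) -` B \<inter> space M \<in> sets M"
    using assms[OF FB(2)] FB(3) by (rule measurable_sets)
  then show "h -` A \<inter> space M \<in> sets M"
    by (simp add: FB(1) vimage_def)
qed auto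

lemma measurable_ident_baire: "(\<lambda>x. x) \<in> borel \<rightarrow>\<^sub>M baire"
  by (rule measurable_into_baire)
     (auto simp: compact_support_continuous_def intro: borel_measurable_continuous_onI)

lemma sets_baire_subset: "A \<in> sets baire \<Longrightarrow> A \<in> sets borel"
  using measurable_sets[OF measurable_ident_baire, of A] by simp

lemma compact_support_translate:
  fixes F :: "'a::topological_group_add \<Rightarrow> real"
  assumes "compact_support_continuous F"
  shows "compact_support_continuous (\<lambda>x. F (a + x))"
proof -
  obtain K where K: "compact K" "\<And>x. x \<notin> K \<Longrightarrow> F x = 0" and F: "continuous_on UNIV F"
    using assms by (auto simp: compact_support_continuous_def)
  have "compact ((\<lambda>x. - a + x) ` K)"
    by (intro compact_continuous_image continuous_on_translate_left K)
  moreover have "F (a + x) = 0" if "x \<notin> (\<lambda>x. - a + x) ` K" for x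
    using that K(2)[of "a + x"] unfolding vimage_add_left[symmetric] by simp
  moreover have "continuous_on UNIV (\<lambda>x. F (a + x))"
    using continuous_on_compose2[OF F continuous_on_translate_left[of UNIV a]] by auto
  ultimately show ?thesis
    by (auto simp: compact_support_continuous_def)
qed

text \<open>Uniform continuity with respect to left multiplication by small elements: on the support it
  comes from compactness, and a point outside is handled by moving it back into the support.\<close>

lemma compact_support_uniformly_continuous:
  fixes F :: "'a::topological_group_add \<Rightarrow> real"
  assumes F: "compact_support_continuous F" and e: "e > 0"
  obtains V where "open V" "0 \<in> V" "\<And>v x. v \<in> V \<Longrightarrow> \<bar>F (v + x) - F x\<bar> < e"
proof -
  obtain K where K: "compact K" "\<And>x. x \<notin> K \<Longrightarrow> F x = 0" and cont: "continuous_on UNIV F"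
    using F by (auto simp: compact_support_continuous_def)
  have "continuous_on UNIV (\<lambda>z. \<bar>F (fst z + snd z) - F (snd z)\<bar>)"
    by (intro continuous_intros continuous_on_compose2[OF cont]) auto
  then have op: "open ((\<lambda>z. \<bar>F (fst z + snd z) - F (snd z)\<bar>) -` {..<e})"
    by (intro open_vimage) auto
  have sub: "{0} \<times> K \<subseteq> (\<lambda>z. \<bar>F (fst z + snd z) - F (snd z)\<bar>) -` {..<e}"
    using e by auto
  obtain V0 where V0: "0 \<in> V0" "open V0"
    "V0 \<times> K \<subseteq> (\<lambda>z. \<bar>F (fst z + snd z) - F (snd z)\<bar>) -` {..<e}"
    using Elementary_Topology.tube_lemma[OF K(1) op sub] by (elim exE conjE)
  \<comment> \<open>symmetrized, to be able to move a point back into the support\<close>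
  define V where "V = V0 \<inter> uminus -` V0"
  have "open (uminus -` V0)"
    by (rule open_vimage[OF V0(2)]) (intro continuous_intros)
  then have "open V" "0 \<in> V"
    using V0 by (auto simp: V_def)
  moreover have "\<bar>F (v + x) - F x\<bar> < e" if v: "v \<in> V" for v x
  proof -
    consider "x \<in> K" | "v + x \<in> K" | "x \<notin> K" "v + x \<notin> K" by auto
    then show ?thesis
    proof cases
      case 1
      then show ?thesis using V0(3) v by (auto simp: V_def)
    next
      case 2
      then have "(- v, v + x) \<in> V0 \<times> K"
        using v by (auto simp: V_def)
      then have "\<bar>F (- v + (v + x)) - F (v + x)\<bar> < e"
        using V0(3) by auto
      then show ?thesis
        by simp
    next
      case 3
      then show ?thesis using K(2) e by simp
    qed
  qed
  ultimately show ?thesis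
    by (rule that)
qed

context compactly_generated_group
begin

text \<open>For a large group the Borel sets of \<open>G \<times> G\<close> are not generated by Borel rectangles, so the
  multiplication need not be measurable for the Borel sets. For Baire sets it is: a left uniformly
  continuous \<open>F\<close> makes \<open>F (u + x)\<close> a uniform limit of functions \<open>F (a i + x)\<close>, with the index \<open>i\<close>
  depending measurably on \<open>u\<close> and ranging over a countable set.\<close>

lemma measurable_action:
  "(\<lambda>(u::'a, x). u + x) \<in> borel \<Otimes>\<^sub>M baire \<rightarrow>\<^sub>M baire"
proof (rule measurable_into_baire, unfold case_prod_beta)
  fix F :: "'a \<Rightarrow> real" assume F: "compact_support_continuous F"
  have "\<exists>G. G \<in> borel_measurable (borel \<Otimes>\<^sub>M baire) \<and>
    (\<forall>z. \<bar>F (fst z + snd z) - G z\<bar> < 1 / real (Suc k))" for k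
  proof -
    have "1 / real (Suc k) > 0" by simp
    then obtain V where V: "open V" "0 \<in> V" "\<And>v x. v \<in> V \<Longrightarrow> \<bar>F (v + x) - F x\<bar> < 1 / real (Suc k)"
      using compact_support_uniformly_continuous[OF F] by blast
    obtain a :: "nat \<Rightarrow> 'a" where a: "(\<Union>i. (\<lambda>v. v + a i) ` V) = UNIV"
      using countable_cover_translates[OF V(1,2)] .
    define idx where "idx u = (LEAST i. u \<in> (\<lambda>v. v + a i) ` V)" for u
    have idx: "u \<in> (\<lambda>v. v + a (idx u)) ` V" for u
      unfolding idx_def by (rule LeastI_ex) (use a in blast)
    have [measurable]: "(\<lambda>v. v + a i) ` V \<in> sets borel" for i
      by (intro borel_open open_translate_right V)
    have [measurable]: "idx \<in> borel \<rightarrow>\<^sub>M count_space UNIV"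
      unfolding idx_def by measurable
    define G where "G z = F (a (idx (fst z)) + snd z)" for z
    have "G \<in> borel_measurable (borel \<Otimes>\<^sub>M baire)"
      unfolding G_def
    proof (rule measurable_compose_countable)
      show "(\<lambda>x. idx (fst x)) \<in> borel \<Otimes>\<^sub>M baire \<rightarrow>\<^sub>M count_space UNIV"
        by measurable
      show "(\<lambda>x. F (a i + snd x)) \<in> borel_measurable (borel \<Otimes>\<^sub>M baire)" for i
        by (rule measurable_compose[OF measurable_snd measurable_baire_fun])
           (rule compact_support_translate[OF F])
    qed
    moreover have "\<bar>F (fst z + snd z) - G z\<bar> < 1 / real (Suc k)" for z
    proof -
      obtain v where "v \<in> V" "fst z = v + a (idx (fst z))"
        using idx[of "fst z"] by auto
      then have "F (fst z + snd z) = F (v + (a (idx (fst z)) + snd z))"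
        by (metis add.assoc)
      then show ?thesis
        using V(3)[OF \<open>v \<in> V\<close>] unfolding G_def by metis
    qed
    ultimately show ?thesis by blast
  qed
  then obtain G where G: "\<And>k. G k \<in> borel_measurable (borel \<Otimes>\<^sub>M baire)"
    "\<And>k z. \<bar>F (fst z + snd z) - G k z\<bar> < 1 / real (Suc k)"
    by metis
  show "(\<lambda>x. F (fst x + snd x)) \<in> borel_measurable (borel \<Otimes>\<^sub>M baire)"
  proof (rule borel_measurable_LIMSEQ_real[OF _ G(1)])
    fix z :: "'a \<times> 'a"
    show "(\<lambda>i. G i z) \<longlonglongrightarrow> F (fst z + snd z)"
    proof (rule LIMSEQ_I)
      fix r :: real assume "r > 0"
      then obtain N where N: "1 / real (Suc N) < r"
        using nat_approx_posE by blast
      show "\<exists>no. \<forall>n\<ge>no. norm (G n z - F (fst z + snd z)) < r"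
      proof (intro exI allI impI)
        fix n assume "n \<ge> N"
        then have "1 / real (Suc n) \<le> 1 / real (Suc N)"
          by (simp add: frac_le)
        then show "norm (G n z - F (fst z + snd z)) < r"
          using G(2)[of z n] N by (simp add: abs_minus_commute)
      qed
    qed
  qed
qed

lemma measurable_add_baire:
  assumes "u \<in> M \<rightarrow>\<^sub>M borel" "x \<in> M \<rightarrow>\<^sub>M baire"
  shows "(\<lambda>z. u z + x z :: 'a) \<in> M \<rightarrow>\<^sub>M baire"
  using measurable_compose[OF measurable_Pair[OF assms] measurable_action] by simp

text \<open>The positivity set of a Urysohn function supported in a compact neighbourhood of \<open>C\<close>.\<close>

lemma baire_between:
  fixes C W :: "'a set"
  assumes C: "compact C" and W: "open W" "C \<subseteq> W"
  obtains B K where "B \<in> sets baire" "open B" "C \<subseteq> B" "B \<subseteq> W" "B \<subseteq> K" "compact K"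
proof -
  obtain U L where UL: "open U" "compact L" "C \<subseteq> U" "U \<subseteq> L"
    using compact_neighbourhood[OF C] .
  obtain F where F: "continuous_map euclidean euclideanreal F" "F ` (- (U \<inter> W)) \<subseteq> {0}" "F ` C \<subseteq> {1}"
  proof (rule Urysohn_completely_regular_compact_closed_alt[OF completely_regular, of C "- (U \<inter> W)" 0 1])
    show "compactin euclidean C" "closedin euclidean (- (U \<inter> W))" "disjnt C (- (U \<inter> W))"
      using C UL W by (auto simp: disjnt_def)
  qed auto
  have cont: "continuous_on UNIV F"
    using F(1) by simp
  have "F x = 0" if "x \<notin> L" for x
    using F(2) UL(4) that by auto
  then have csc: "compact_support_continuous F"
    using cont UL(2) by (auto simp: compact_support_continuous_def)
  show ?thesis
  proof
    show "F -` {0<..} \<in> sets baire"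
      using measurable_sets[OF measurable_baire_fun[OF csc], of "{0<..}"] by simp
    show "open (F -` {0<..})"
      by (rule open_vimage[OF _ cont]) simp
    show "C \<subseteq> F -` {0<..}"
      using F(3) by auto
    have *: "F -` {0<..} \<subseteq> U \<inter> W"
    proof
      fix x assume "x \<in> F -` {0<..}"
      moreover have "F x \<in> {0}" if "x \<in> - (U \<inter> W)"
        using F(2) imageI[OF that, of F] by blast
      ultimately show "x \<in> U \<inter> W"
        by fastforce
    qed
    show "F -` {0<..} \<subseteq> W" "F -` {0<..} \<subseteq> L" "compact L"
      using * UL by blast+
  qed
qed

end

section \<open>Lebesgue norms\<close>

text \<open>The extension of \<open>x powr r\<close> to \<open>ennreal\<close>, in terms of which the norm for \<open>p < \<infinity>\<close> is
  the \<open>1/p\<close>-th power of an integral.\<close>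

definition epow :: "real \<Rightarrow> ennreal \<Rightarrow> ennreal" where
  "epow r x = (if x = \<infinity> then \<infinity> else ennreal (enn2real x powr r))"

definition pow_integral :: "'a measure \<Rightarrow> real \<Rightarrow> ('a \<Rightarrow> real) \<Rightarrow> ennreal" where
  "pow_integral M q f = (\<integral>\<^sup>+ x. ennreal (\<bar>f x\<bar> powr q) \<partial>M)"

lemma Lp_norm_finite: "p \<noteq> \<infinity> \<Longrightarrow> Lp_norm M p f = epow (1 / enn2real p) (pow_integral M (enn2real p) f)"
  by (simp add: Lp_norm_def epow_def Let_def pow_integral_def)

lemma Lp_norm_infinity: "Lp_norm M top f = esssup M (\<lambda>x. ennreal \<bar>f x\<bar>)"
  by (simp add: Lp_norm_def)

lemma epow_0 [simp]: "epow r 0 = 0"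
  by (simp add: epow_def)

lemma epow_ennreal: "a \<ge> 0 \<Longrightarrow> epow r (ennreal a) = ennreal (a powr r)"
  by (simp add: epow_def)

lemma epow_eq_top_iff [simp]: "epow r x = \<infinity> \<longleftrightarrow> x = \<infinity>" "epow r x = top \<longleftrightarrow> x = top"
  by (auto simp: epow_def)

lemma epow_less_top_iff [simp]: "epow r x < \<infinity> \<longleftrightarrow> x < \<infinity>" "epow r x < top \<longleftrightarrow> x < top"
  by (auto simp: epow_def less_top)

lemma epow_eq_0_iff [simp]: "epow r x = 0 \<longleftrightarrow> x = 0"
  by (cases x) (auto simp: epow_def)

lemma epow_mono: "0 < r \<Longrightarrow> x \<le> y \<Longrightarrow> epow r x \<le> epow r y"
  by (cases x; cases y) (auto simp: epow_def top_unique intro!: ennreal_leI powr_mono2)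

lemma epow_epow: "epow r (epow s x) = epow (r * s) x"
  by (cases x) (auto simp: epow_def powr_powr mult.commute)

lemma epow_1 [simp]: "epow 1 x = x"
  by (cases x) (auto simp: epow_def)

lemma epow_mult: "epow r (x * y) = epow r x * epow r y"
proof (cases "x = \<infinity> \<or> y = \<infinity>")
  case True
  then show ?thesis
    by (cases x; cases y) (auto simp: ennreal_mult_top ennreal_top_mult epow_def split: if_splits)
next
  case False
  then show ?thesis
    by (cases x; cases y) (auto simp: epow_def ennreal_mult[symmetric] enn2real_mult powr_mult)
qed

lemma powr_add_le:
  fixes a b :: real
  assumes "a \<ge> 0" "b \<ge> 0" "r > 0"
  shows "(a + b) powr r \<le> 2 powr r * (a powr r + b powr r)"
proof -
  have "(a + b) powr r \<le> (2 * max a b) powr r"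
    using assms by (intro powr_mono2) auto
  also have "\<dots> = 2 powr r * (max a b) powr r"
    using assms by (simp add: powr_mult)
  also have "\<dots> \<le> 2 powr r * (a powr r + b powr r)"
    using assms by (intro mult_left_mono) (auto simp: max_def)
  finally show ?thesis .
qed

lemma epow_add_le:
  assumes "r > 0"
  shows "epow r (x + y) \<le> ennreal (2 powr r) * (epow r x + epow r y)"
proof (cases "x = \<infinity> \<or> y = \<infinity>")
  case True
  then show ?thesis
    by (auto simp: epow_def ennreal_mult_top)
next
  case False
  then obtain a b where ab: "x = ennreal a" "y = ennreal b" "a \<ge> 0" "b \<ge> 0"
    by (cases x; cases y) auto
  have "epow r (x + y) = ennreal ((a + b) powr r)"
    using ab by (simp add: epow_ennreal flip: ennreal_plus)
  also have "\<dots> \<le> ennreal (2 powr r * (a powr r + b powr r))"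
    by (intro ennreal_leI powr_add_le ab assms)
  also have "\<dots> = ennreal (2 powr r) * (epow r x + epow r y)"
    using ab by (simp add: epow_ennreal ennreal_mult)
  finally show ?thesis .
qed

lemma pow_integral_add_le:
  fixes f g :: "'a \<Rightarrow> real"
  assumes [measurable]: "f \<in> borel_measurable M" "g \<in> borel_measurable M" and q: "q > 0"
  shows "pow_integral M q (\<lambda>x. f x + g x)
    \<le> ennreal (2 powr q) * (pow_integral M q f + pow_integral M q g)"
proof -
  have "pow_integral M q (\<lambda>x. f x + g x)
    \<le> (\<integral>\<^sup>+ x. ennreal (2 powr q) * (ennreal (\<bar>f x\<bar> powr q) + ennreal (\<bar>g x\<bar> powr q)) \<partial>M)"
    unfolding pow_integral_def
  proof (rule nn_integral_mono)
    fix x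
    have "\<bar>f x + g x\<bar> powr q \<le> (\<bar>f x\<bar> + \<bar>g x\<bar>) powr q"
      using q by (intro powr_mono2) auto
    also have "\<dots> \<le> 2 powr q * (\<bar>f x\<bar> powr q + \<bar>g x\<bar> powr q)"
      using q by (intro powr_add_le) auto
    finally show "ennreal (\<bar>f x + g x\<bar> powr q)
      \<le> ennreal (2 powr q) * (ennreal (\<bar>f x\<bar> powr q) + ennreal (\<bar>g x\<bar> powr q))"
      by (simp add: ennreal_mult[symmetric] ennreal_leI flip: ennreal_plus)
  qed
  also have "\<dots> = ennreal (2 powr q) * (pow_integral M q f + pow_integral M q g)"
    unfolding pow_integral_def by (subst nn_integral_cmult) (auto simp: nn_integral_add)
  finally show ?thesis .
qed

text \<open>A triangle inequality up to a constant, which spares Minkowski's inequality; constants are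
  immaterial for the comparison of profiles.\<close>

lemma Lp_norm_add_le:
  fixes f g :: "'a \<Rightarrow> real"
  assumes [measurable]: "f \<in> borel_measurable M" "g \<in> borel_measurable M" and p: "1 \<le> p"
  shows "Lp_norm M p (\<lambda>x. f x + g x) \<le> 4 * (Lp_norm M p f + Lp_norm M p g)"
proof (cases "p = \<infinity>")
  case True
  have "esssup M (\<lambda>x. ennreal \<bar>f x + g x\<bar>)
    \<le> esssup M (\<lambda>x. ennreal \<bar>f x\<bar>) + esssup M (\<lambda>x. ennreal \<bar>g x\<bar>)"
  proof (rule esssup_I)
    show "AE x in M. ennreal \<bar>f x + g x\<bar>
      \<le> esssup M (\<lambda>x. ennreal \<bar>f x\<bar>) + esssup M (\<lambda>x. ennreal \<bar>g x\<bar>)"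
      using esssup_AE[of "\<lambda>x. ennreal \<bar>f x\<bar>" M] esssup_AE[of "\<lambda>x. ennreal \<bar>g x\<bar>" M]
    proof eventually_elim
      case (elim x)
      have "ennreal \<bar>f x + g x\<bar> \<le> ennreal \<bar>f x\<bar> + ennreal \<bar>g x\<bar>"
        by (simp add: ennreal_leI flip: ennreal_plus)
      also have "\<dots> \<le> esssup M (\<lambda>x. ennreal \<bar>f x\<bar>) + esssup M (\<lambda>x. ennreal \<bar>g x\<bar>)"
        by (intro add_mono elim)
      finally show ?case .
    qed
  qed measurable
  also have "\<dots> \<le> 4 * (esssup M (\<lambda>x. ennreal \<bar>f x\<bar>) + esssup M (\<lambda>x. ennreal \<bar>g x\<bar>))"
    using mult_right_mono[of 1 "4 :: ennreal"
      "esssup M (\<lambda>x. ennreal \<bar>f x\<bar>) + esssup M (\<lambda>x. ennreal \<bar>g x\<bar>)"] by simp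
  finally show ?thesis
    using True by (simp add: Lp_norm_infinity)
next
  case False
  define q where "q = enn2real p"
  have q: "q \<ge> 1"
    using p False unfolding q_def by (cases p) auto
  have "epow (1 / q) (pow_integral M q (\<lambda>x. f x + g x))
    \<le> epow (1 / q) (ennreal (2 powr q) * (pow_integral M q f + pow_integral M q g))"
    using q by (intro epow_mono pow_integral_add_le) auto
  also have "\<dots> = 2 * epow (1 / q) (pow_integral M q f + pow_integral M q g)"
    using q by (simp add: epow_mult epow_ennreal powr_powr)
  also have "\<dots> \<le> 2 * (ennreal (2 powr (1 / q)) *
      (epow (1 / q) (pow_integral M q f) + epow (1 / q) (pow_integral M q g)))"
    using q by (intro mult_left_mono epow_add_le) auto
  also have "\<dots> \<le> 2 * (ennreal 2 *
      (epow (1 / q) (pow_integral M q f) + epow (1 / q) (pow_integral M q g)))"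
    using q powr_mono[of "1 / q" 1 2] by (intro mult_left_mono mult_right_mono ennreal_leI) auto
  also have "\<dots> = 4 * (epow (1 / q) (pow_integral M q f) + epow (1 / q) (pow_integral M q g))"
    by (simp add: mult.assoc[symmetric])
  finally show ?thesis
    using False by (simp add: Lp_norm_finite q_def)
qed

lemma Lp_norm_mono_AE:
  fixes f g :: "'a \<Rightarrow> real"
  assumes [measurable]: "f \<in> borel_measurable M" "g \<in> borel_measurable M" and p: "1 \<le> p"
    and le: "AE x in M. \<bar>f x\<bar> \<le> \<bar>g x\<bar>"
  shows "Lp_norm M p f \<le> Lp_norm M p g"
proof (cases "p = \<infinity>")
  case True
  have "esssup M (\<lambda>x. ennreal \<bar>f x\<bar>) \<le> esssup M (\<lambda>x. ennreal \<bar>g x\<bar>)"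
    using le by (intro esssup_AE_mono) (auto intro: ennreal_leI)
  then show ?thesis
    using True by (simp add: Lp_norm_infinity)
next
  case False
  define q where "q = enn2real p"
  have q: "q \<ge> 1"
    using p False unfolding q_def by (cases p) auto
  have "pow_integral M q f \<le> pow_integral M q g"
    unfolding pow_integral_def
    using le q by (intro nn_integral_mono_AE) (auto intro!: ennreal_leI powr_mono2)
  then show ?thesis
    using False q by (auto simp: Lp_norm_finite q_def intro!: epow_mono)
qed

lemma Lp_norm_cong_AE:
  fixes f g :: "'a \<Rightarrow> real"
  assumes "f \<in> borel_measurable M" "g \<in> borel_measurable M" "1 \<le> p" "AE x in M. f x = g x"
  shows "Lp_norm M p f = Lp_norm M p g"
  using assms by (intro antisym Lp_norm_mono_AE) auto

lemma Lp_norm_minus: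
  fixes f :: "'a \<Rightarrow> real"
  shows "Lp_norm M p (\<lambda>x. - f x) = Lp_norm M p f"
  by (simp add: Lp_norm_def)

lemma Lp_norm_diff_le:
  fixes f g :: "'a \<Rightarrow> real"
  assumes "f \<in> borel_measurable M" "g \<in> borel_measurable M" "1 \<le> p"
  shows "Lp_norm M p (\<lambda>x. f x - g x) \<le> 4 * (Lp_norm M p f + Lp_norm M p g)"
  using Lp_norm_add_le[of f M "\<lambda>x. - g x" p] assms by (simp add: Lp_norm_minus)

lemma Lp_norm_zero:
  assumes "1 \<le> p"
  shows "Lp_norm M p (\<lambda>x. 0) = 0"
proof (cases "p = \<infinity>")
  case True
  have "esssup M (\<lambda>x. 0 :: ennreal) \<le> 0"
    by (rule esssup_I) auto
  then show ?thesis
    using True by (simp add: Lp_norm_infinity)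
next
  case False
  then show ?thesis
    by (simp add: Lp_norm_finite pow_integral_def)
qed

lemma Lp_norm_eq_0:
  fixes f :: "'a \<Rightarrow> real"
  assumes [measurable]: "f \<in> borel_measurable M" and p: "1 \<le> p" and 0: "Lp_norm M p f = 0"
  shows "AE x in M. f x = 0"
proof (cases "p = \<infinity>")
  case True
  then show ?thesis
    using esssup_AE[of "\<lambda>x. ennreal \<bar>f x\<bar>" M] 0 by (simp add: Lp_norm_infinity)
next
  case False
  then have "pow_integral M (enn2real p) f = 0"
    using 0 by (simp add: Lp_norm_finite)
  then show ?thesis
    by (simp add: pow_integral_def nn_integral_0_iff_AE)
qed

lemma pow_integral_distr:
  assumes [measurable]: "h \<in> M \<rightarrow>\<^sub>M M" "f \<in> borel_measurable M" and d: "distr M M h = M"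
  shows "pow_integral M q (\<lambda>x. f (h x)) = pow_integral M q f"
proof -
  have "pow_integral M q f = (\<integral>\<^sup>+ x. ennreal (\<bar>f x\<bar> powr q) \<partial>(distr M M h))"
    by (simp add: d pow_integral_def)
  then show ?thesis
    by (simp add: nn_integral_distr pow_integral_def)
qed

lemma Lp_norm_distr:
  fixes f :: "'a \<Rightarrow> real"
  assumes h [measurable]: "h \<in> M \<rightarrow>\<^sub>M M" and f [measurable]: "f \<in> borel_measurable M"
    and d: "distr M M h = M"
  shows "Lp_norm M p (\<lambda>x. f (h x)) = Lp_norm M p f"
proof (cases "p = \<infinity>")
  case True
  have "(AE x in M. ennreal \<bar>f x\<bar> \<le> z) \<longleftrightarrow> (AE x in M. ennreal \<bar>f (h x)\<bar> \<le> z)" for z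
    using AE_distr_iff[OF h, of "\<lambda>x. ennreal \<bar>f x\<bar> \<le> z"] unfolding d by simp
  then show ?thesis
    using True by (simp add: Lp_norm_infinity esssup_eq_AE)
next
  case False
  then show ?thesis
    by (simp add: Lp_norm_finite pow_integral_distr[OF h f d])
qed

definition gradient :: "'a::group_add measure \<Rightarrow> 'a set \<Rightarrow> ennreal \<Rightarrow> ('a \<Rightarrow> real) \<Rightarrow> ennreal" where
  "gradient M S p f = (SUP s\<in>S. Lp_norm M p (\<lambda>x. f x - left_translate s f x))"

section \<open>Haar measures of subgroups\<close>

text \<open>A closed subgroup with its own Haar measure and generating set. The whole group is the instance
  \<open>K = UNIV\<close>, \<open>T = S\<close>, so that facts proved here serve both groups.\<close>

locale haar_subgroup = compactly_generated_group S
  for S :: "'a::{topological_group_add, t2_space} set" +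
  fixes K T :: "'a set" and \<nu> :: "'a measure"
  assumes subgroup: "is_subgroup K" and closed: "closed K"
    and generating_K: "compact_symmetric_generating K T"
    and haar: "left_haar_measure K \<nu>"
begin

lemma zero_in: "0 \<in> K" and add_in: "x \<in> K \<Longrightarrow> y \<in> K \<Longrightarrow> x + y \<in> K"
  and uminus_in: "x \<in> K \<Longrightarrow> - x \<in> K"
  using subgroup by (auto simp: is_subgroup_def)

lemma uminus_in_iff [simp]: "- x \<in> K \<longleftrightarrow> x \<in> K"
  using uminus_in[of x] uminus_in[of "- x"] by auto

lemma compact_T: "compact T" and uminus_T: "uminus ` T = T"
  and Union_set_power_T: "(\<Union>n. set_power T n) = K"
  using generating_K by (auto simp: compact_symmetric_generating_def)

lemma set_power_T_subset: "set_power T n \<subseteq> K"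
  using Union_set_power_T by auto

lemma T_subset: "T \<subseteq> K"
  using set_power_T_subset[of "Suc 0"] by force

lemma sets_haar: "sets \<nu> = sets (restrict_space borel K)"
  using haar by (simp add: left_haar_measure_def)

lemma space_haar [simp]: "space \<nu> = K"
  using sets_eq_imp_space_eq[OF sets_haar] by (simp add: space_restrict_space)

lemma K_borel [measurable]: "K \<in> sets borel"
  using closed by simp

lemma in_sets_iff: "A \<in> sets \<nu> \<longleftrightarrow> A \<in> sets borel \<and> A \<subseteq> K"
  unfolding sets_haar by (subst sets_restrict_space_iff) auto

lemma measurable_haar_I: "f \<in> borel \<rightarrow>\<^sub>M N \<Longrightarrow> f \<in> \<nu> \<rightarrow>\<^sub>M N"
  using measurable_cong_sets[OF sets_haar refl] measurable_restrict_space1 by blast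

lemma measurable_into_haar: "f \<in> M \<rightarrow>\<^sub>M borel \<Longrightarrow> (\<And>x. x \<in> space M \<Longrightarrow> f x \<in> K) \<Longrightarrow> f \<in> M \<rightarrow>\<^sub>M \<nu>"
  unfolding measurable_cong_sets[OF refl sets_haar] by (intro measurable_restrict_space2) auto

lemma measurable_ident_haar: "(\<lambda>x. x) \<in> \<nu> \<rightarrow>\<^sub>M borel"
  by (rule measurable_haar_I) simp

lemma measurable_left_translation: "g \<in> K \<Longrightarrow> (\<lambda>x. g + x) \<in> \<nu> \<rightarrow>\<^sub>M \<nu>"
  by (intro measurable_into_haar measurable_haar_I borel_measurable_continuous_onI
      continuous_on_translate_left) (simp add: add_in)

lemma measurable_right_translation: "(\<lambda>x. x + g) \<in> \<nu> \<rightarrow>\<^sub>M borel"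
  by (intro measurable_haar_I borel_measurable_continuous_onI continuous_on_translate_right)

lemma measurable_right_translation': "g \<in> K \<Longrightarrow> (\<lambda>x. x + g) \<in> \<nu> \<rightarrow>\<^sub>M \<nu>"
  by (intro measurable_into_haar measurable_right_translation) (simp add: add_in)

lemma distr_left_translation:
  assumes g: "g \<in> K" shows "distr \<nu> \<nu> (\<lambda>x. g + x) = \<nu>"
proof (rule measure_eqI)
  fix A assume "A \<in> sets (distr \<nu> \<nu> (\<lambda>x. g + x))"
  then have A: "A \<in> sets \<nu>" by simp
  have "(\<lambda>x. g + x) -` A \<inter> K = (\<lambda>x. - g + x) ` A"
    using A g unfolding vimage_add_left by (auto simp: in_sets_iff intro!: add_in)
  moreover have "emeasure \<nu> ((\<lambda>x. - g + x) ` A) = emeasure \<nu> A"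
    using haar A g unfolding left_haar_measure_def by (metis uminus_in)
  ultimately show "emeasure (distr \<nu> \<nu> (\<lambda>x. g + x)) A = emeasure \<nu> A"
    by (simp add: emeasure_distr[OF measurable_left_translation[OF g] A])
qed simp

lemma emeasure_compact_finite: "compact C \<Longrightarrow> C \<subseteq> K \<Longrightarrow> emeasure \<nu> C < \<infinity>"
  using haar by (simp add: left_haar_measure_def)

lemma compact_in_sets: "compact C \<Longrightarrow> C \<subseteq> K \<Longrightarrow> C \<in> sets \<nu>"
  by (auto simp: in_sets_iff intro: borel_closed compact_imp_closed)

lemma compact_set_power_T: "compact (set_power T n)"
  by (rule compact_set_power[OF compact_T])

lemma sigma_finite: "sigma_finite_measure \<nu>"
proof
  show "\<exists>A. countable A \<and> A \<subseteq> sets \<nu> \<and> \<Union> A = space \<nu> \<and> (\<forall>a\<in>A. emeasure \<nu> a \<noteq> \<infinity>)"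
  proof (intro exI[of _ "range (set_power T)"] conjI ballI)
    show "range (set_power T) \<subseteq> sets \<nu>"
      using compact_in_sets compact_set_power_T set_power_T_subset by auto
    fix a assume "a \<in> range (set_power T)"
    then show "emeasure \<nu> a \<noteq> \<infinity>"
      using emeasure_compact_finite[OF compact_set_power_T set_power_T_subset] by (auto simp: less_top)
  qed (auto simp: Union_set_power_T)
qed

lemma emeasure_space_pos: "emeasure \<nu> K \<noteq> 0"
  using haar unfolding left_haar_measure_def by blast

text \<open>Countably many balls cover \<open>K\<close>, so one of them has positive measure.\<close>

lemma ball_positive_measure:
  obtains n where "emeasure \<nu> (set_power T n) > 0" "emeasure \<nu> (set_power T n) < \<infinity>"
    "set_power T n \<in> sets \<nu>"
proof -
  have s: "set_power T n \<in> sets \<nu>" for n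
    using compact_in_sets compact_set_power_T set_power_T_subset by auto
  have "\<exists>n. emeasure \<nu> (set_power T n) > 0"
  proof (rule ccontr)
    assume "\<not> ?thesis"
    then have "emeasure \<nu> (\<Union>n. set_power T n) = 0"
      using s by (intro emeasure_UN_eq_0) auto
    then show False
      using emeasure_space_pos Union_set_power_T by simp
  qed
  then show ?thesis
    using that s emeasure_compact_finite[OF compact_set_power_T set_power_T_subset] by auto
qed

lemma left_translate_measurable:
  assumes "f \<in> borel_measurable \<nu>" "g \<in> K"
  shows "left_translate g f \<in> borel_measurable \<nu>"
  unfolding left_translate_def
  using measurable_compose[OF measurable_left_translation assms(1), of "- g"] assms(2) by simp

lemma Lp_norm_left_translate:
  assumes "f \<in> borel_measurable \<nu>" "g \<in> K"
  shows "Lp_norm \<nu> p (left_translate g f) = Lp_norm \<nu> p f"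
  unfolding left_translate_def
  using assms by (intro Lp_norm_distr measurable_left_translation distr_left_translation) auto

lemma AE_left_translation:
  assumes g: "g \<in> K" and P: "AE x in \<nu>. P x" shows "AE x in \<nu>. P (g + x)"
proof -
  have "AE x in distr \<nu> \<nu> (\<lambda>x. g + x). P x"
    using P unfolding distr_left_translation[OF g] .
  then show ?thesis
    by (rule AE_distrD[OF measurable_left_translation[OF g]])
qed

lemma nn_integral_left_translation:
  assumes g: "g \<in> K" and f: "f \<in> borel_measurable \<nu>"
  shows "(\<integral>\<^sup>+ x. f (g + x) \<partial>\<nu>) = (\<integral>\<^sup>+ x. f x \<partial>\<nu>)"
  using nn_integral_distr[OF measurable_left_translation[OF g], of f] f
  unfolding distr_left_translation[OF g] by simp

text \<open>Decompose a word letter by letter; left translations are isometries, so each letter costs one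
  gradient, up to the constant of the triangle inequality.\<close>

lemma displacement_le_gradient:
  assumes p: "1 \<le> p"
  shows "\<exists>C::real. C > 0 \<and> (\<forall>f x. f \<in> borel_measurable \<nu> \<longrightarrow> x \<in> (\<Union>n\<le>N. set_power T n) \<longrightarrow>
      Lp_norm \<nu> p (\<lambda>y. f y - left_translate x f y) \<le> ennreal C * gradient \<nu> T p f)"
proof -
  define D where "D f x = Lp_norm \<nu> p (\<lambda>y. f y - left_translate x f y)" for f :: "'a \<Rightarrow> real" and x
  have step: "D f (s + x) \<le> 4 * (D f s + D f x)"
    if f: "f \<in> borel_measurable \<nu>" and sx: "s \<in> K" "x \<in> K" for f s x
  proof -
    have [measurable]: "f \<in> borel_measurable \<nu>" "left_translate s f \<in> borel_measurable \<nu>"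
      "left_translate x f \<in> borel_measurable \<nu>" "left_translate (s + x) f \<in> borel_measurable \<nu>"
      using left_translate_measurable f sx add_in by auto
    have eq: "left_translate s (\<lambda>y. f y - left_translate x f y)
      = (\<lambda>y. left_translate s f y - left_translate (s + x) f y)"
      by (auto simp: left_translate_def minus_add add.assoc fun_eq_iff simp del: add_uminus_conv_diff)
    have "D f (s + x) = Lp_norm \<nu> p (\<lambda>y. (f y - left_translate s f y)
        + left_translate s (\<lambda>y. f y - left_translate x f y) y)"
      unfolding D_def eq by simp
    also have "\<dots> \<le> 4 * (D f s + Lp_norm \<nu> p (left_translate s (\<lambda>y. f y - left_translate x f y)))"
      unfolding D_def
      by (rule Lp_norm_add_le) (auto intro!: left_translate_measurable sx p)
    also have "Lp_norm \<nu> p (left_translate s (\<lambda>y. f y - left_translate x f y)) = D f x"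
      unfolding D_def by (rule Lp_norm_left_translate) (auto intro: sx)
    finally show ?thesis .
  qed
  have "\<exists>C>0. \<forall>f x. f \<in> borel_measurable \<nu> \<longrightarrow> x \<in> set_power T n \<longrightarrow>
      D f x \<le> ennreal C * (SUP s\<in>T. D f s)" for n
  proof (induction n)
    case 0
    have "D f 0 = 0" for f
      using p by (simp add: D_def left_translate_def Lp_norm_zero)
    then show ?case
      by (intro exI[of _ 1]) auto
  next
    case (Suc n)
    then obtain C where C: "C > 0" "\<And>f x. f \<in> borel_measurable \<nu> \<Longrightarrow> x \<in> set_power T n \<Longrightarrow>
      D f x \<le> ennreal C * (SUP s\<in>T. D f s)" by blast
    have "D f x \<le> ennreal (4 * (1 + C)) * (SUP s\<in>T. D f s)"
      if f: "f \<in> borel_measurable \<nu>" and "x \<in> set_power T (Suc n)" for f x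
    proof -
      obtain s y where sy: "x = s + y" "s \<in> T" "y \<in> set_power T n"
        using \<open>x \<in> set_power T (Suc n)\<close> by auto
      have "D f x \<le> 4 * (D f s + D f y)"
        unfolding sy(1) using sy T_subset set_power_T_subset by (intro step f) auto
      also have "\<dots> \<le> 4 * ((SUP s\<in>T. D f s) + ennreal C * (SUP s\<in>T. D f s))"
        using sy by (intro mult_left_mono add_mono C f SUP_upper) auto
      also have "\<dots> = ennreal (4 * (1 + C)) * (SUP s\<in>T. D f s)"
        using C(1) by (simp add: ennreal_mult ring_distribs mult.assoc)
      finally show ?thesis .
    qed
    then show ?case
      using C(1) by (intro exI[of _ "4 * (1 + C)"]) auto
  qed
  then obtain C where C: "\<And>n. C n > 0" "\<And>n f x. f \<in> borel_measurable \<nu> \<Longrightarrow> x \<in> set_power T n \<Longrightarrow>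
      D f x \<le> ennreal (C n) * (SUP s\<in>T. D f s)"
    by metis
  show ?thesis
  proof (intro exI[of _ "Max (C ` {..N})"] conjI allI impI)
    show "Max (C ` {..N}) > 0"
      using C(1) by (auto simp: Max_gr_iff)
    fix f :: "'a \<Rightarrow> real" and x assume f: "f \<in> borel_measurable \<nu>" and "x \<in> (\<Union>n\<le>N. set_power T n)"
    then obtain n where n: "n \<le> N" "x \<in> set_power T n"
      by auto
    have "D f x \<le> ennreal (C n) * (SUP s\<in>T. D f s)"
      by (rule C(2)[OF f n(2)])
    also have "\<dots> \<le> ennreal (Max (C ` {..N})) * (SUP s\<in>T. D f s)"
      using n(1) by (intro mult_right_mono ennreal_leI Max_ge) auto
    finally show "Lp_norm \<nu> p (\<lambda>y. f y - left_translate x f y)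
        \<le> ennreal (Max (C ` {..N})) * gradient \<nu> T p f"
      by (simp add: D_def gradient_def)
  qed
qed

end

locale unimodular_haar_subgroup = haar_subgroup +
  assumes unimodular: "unimodular K"
begin

lemma distr_right_translation:
  assumes g: "g \<in> K" shows "distr \<nu> \<nu> (\<lambda>x. x + g) = \<nu>"
proof (rule measure_eqI)
  fix A assume "A \<in> sets (distr \<nu> \<nu> (\<lambda>x. x + g))"
  then have A: "A \<in> sets \<nu>" by simp
  have "(\<lambda>x. x + g) -` A \<inter> K = (\<lambda>x. x + - g) ` A"
    using A g unfolding vimage_add_right by (auto simp: in_sets_iff simp del: add_uminus_conv_diff intro!: add_in)
  moreover have "emeasure \<nu> ((\<lambda>x. x + - g) ` A) = emeasure \<nu> A"
    using unimodular haar A g unfolding unimodular_def by (metis uminus_in)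
  ultimately show "emeasure (distr \<nu> \<nu> (\<lambda>x. x + g)) A = emeasure \<nu> A"
    by (simp add: emeasure_distr[OF measurable_right_translation'[OF g] A])
qed simp

lemma emeasure_right_translation:
  assumes g: "g \<in> K" and A: "A \<in> sets \<nu>"
  shows "emeasure \<nu> ((\<lambda>x. x + g) ` A) = emeasure \<nu> A"
  using unimodular haar A g unfolding unimodular_def by metis

end

section \<open>Baire versions of Borel functions\<close>

locale haar_group = haar_subgroup S UNIV S \<mu>
  for S :: "'a::{topological_group_add, t2_space} set" and \<mu>
begin

lemma sets_borel: "sets \<mu> = sets borel"
  using in_sets_iff by auto

lemma ident_baire: "(\<lambda>x. x) \<in> \<mu> \<rightarrow>\<^sub>M baire"
  by (rule measurable_haar_I[OF measurable_ident_baire])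

lemma baire_measurable: "f \<in> baire \<rightarrow>\<^sub>M N \<Longrightarrow> f \<in> \<mu> \<rightarrow>\<^sub>M N"
  by (rule measurable_compose[OF ident_baire])

text \<open>Compact sets need not be Baire sets, so balls are enlarged to open Baire sets.\<close>

lemma baire_exhaustion:
  "\<exists>E L :: nat \<Rightarrow> 'a set. (\<forall>n. E n \<in> sets baire \<and> open (E n) \<and> E n \<subseteq> L n \<and> compact (L n)) \<and>
    (\<Union>n. E n) = UNIV"
proof -
  have "\<exists>B L. B \<in> sets baire \<and> open B \<and> B \<subseteq> L \<and> compact L \<and> set_power S n \<subseteq> B" for n
  proof -
    obtain B L where "B \<in> sets baire" "open B" "set_power S n \<subseteq> B" "B \<subseteq> UNIV" "B \<subseteq> L" "compact L"
      by (rule baire_between[OF compact_set_power_T, of UNIV n]) auto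
    then show ?thesis by blast
  qed
  then obtain E L where EL: "\<And>n. E n \<in> sets baire" "\<And>n. open (E n)" "\<And>n. E n \<subseteq> L n"
    "\<And>n. compact (L n)" "\<And>n. set_power S n \<subseteq> E n"
    by metis
  have "x \<in> (\<Union>n. E n)" for x
    using ex_set_power[of x] EL(5) by auto
  then have "(\<Union>n. E n) = UNIV"
    by (rule UNIV_eq_I[symmetric])
  then show ?thesis
    using EL(1-4) by blast
qed

lemma AE_iff_of_null:
  assumes "A \<in> sets \<mu>" "B \<in> sets \<mu>" "B \<subseteq> A" "emeasure \<mu> (A - B) = 0"
  shows "AE x in \<mu>. x \<in> A \<longleftrightarrow> x \<in> B"
proof -
  have "A - B \<in> null_sets \<mu>"
    using assms by auto
  from AE_not_in[OF this] show ?thesis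
    using assms(3) by (auto elim!: eventually_mono)
qed

text \<open>The compact sets that exhaust \<open>U\<close> in measure are enlarged to Baire sets inside \<open>U\<close>.\<close>

lemma open_baire_version_finite:
  assumes U: "open U" and fin: "emeasure \<mu> U < \<infinity>"
  shows "\<exists>B\<in>sets baire. AE x in \<mu>. x \<in> U \<longleftrightarrow> x \<in> B"
proof -
  let ?C = "{C. compact C \<and> C \<subseteq> U}"
  have "\<forall>U. openin (top_of_set UNIV) U \<longrightarrow> emeasure \<mu> U = (SUP C\<in>{C. compact C \<and> C \<subseteq> U}. emeasure \<mu> C)"
    using haar unfolding left_haar_measure_def by (elim conjE)
  from this[rule_format, of U] U have SUP: "emeasure \<mu> U = (SUP C\<in>?C. emeasure \<mu> C)"
    by simp
  have "emeasure \<mu> ` ?C \<noteq> {}"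
    by auto
  from ennreal_Sup_countable_SUP[OF this] obtain m :: "nat \<Rightarrow> ennreal" where m: "range m \<subseteq> emeasure \<mu> ` ?C" "Sup (emeasure \<mu> ` ?C) = (SUP i. m i)"
    by blast
  have "\<exists>C. compact C \<and> C \<subseteq> U \<and> m i = emeasure \<mu> C" for i
    using m(1) by (auto simp: image_subset_iff)
  then obtain C where C: "\<And>i. compact (C i)" "\<And>i. C i \<subseteq> U" "\<And>i. m i = emeasure \<mu> (C i)"
    by metis
  have "\<exists>B. B \<in> sets baire \<and> C i \<subseteq> B \<and> B \<subseteq> U" for i
  proof -
    obtain B K where "B \<in> sets baire" "open B" "C i \<subseteq> B" "B \<subseteq> U" "B \<subseteq> K" "compact K"
      by (rule baire_between[OF C(1) U C(2)])
    then show ?thesis by blast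
  qed
  then obtain B where B: "\<And>i. B i \<in> sets baire" "\<And>i. C i \<subseteq> B i" "\<And>i. B i \<subseteq> U"
    by metis
  let ?B = "\<Union>i. B i"
  have Bs: "?B \<in> sets baire"
    using B(1) by auto
  have \<mu>s: "?B \<in> sets \<mu>" "U \<in> sets \<mu>" "?B \<subseteq> U"
    using sets_baire_subset[OF Bs] U B(3) by (auto simp: in_sets_iff)
  have "emeasure \<mu> U \<le> emeasure \<mu> ?B"
    unfolding SUP m(2)
  proof (rule SUP_least)
    fix i
    have "C i \<subseteq> ?B"
      using B(2) by blast
    then show "m i \<le> emeasure \<mu> ?B"
      unfolding C(3) by (rule emeasure_mono[OF _ \<mu>s(1)])
  qed
  then have "emeasure \<mu> ?B = emeasure \<mu> U"
    using emeasure_mono[OF \<mu>s(3,2)] by (intro antisym)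
  then have "emeasure \<mu> (U - ?B) = 0"
    using emeasure_Diff[OF _ \<mu>s(2) \<mu>s(1) \<mu>s(3)] fin by (auto simp: less_top)
  then show ?thesis
    using AE_iff_of_null[OF \<mu>s(2) \<mu>s(1) \<mu>s(3)] Bs by blast
qed

text \<open>The sets with this property form a \<open>\<sigma>\<close>-algebra, and open sets belong to it by exhaustion. The
  exceptional null set is only a Borel set: it is not claimed to lie in a Baire null set.\<close>

lemma borel_baire_version:
  assumes "A \<in> sets borel"
  shows "\<exists>B\<in>sets baire. AE x in \<mu>. x \<in> A \<longleftrightarrow> x \<in> B"
proof -
  have "A \<in> sigma_sets UNIV {U. open U}"
    using assms by (simp add: borel_def)
  then show ?thesis
  proof (induction A)
    case (Basic U)
    obtain E L :: "nat \<Rightarrow> 'a set" where EL: "\<And>n. E n \<in> sets baire" "\<And>n. open (E n)" "\<And>n. E n \<subseteq> L n"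
      "\<And>n. compact (L n)" "(\<Union>n. E n) = UNIV"
      using baire_exhaustion by metis
    have "\<exists>B\<in>sets baire. AE x in \<mu>. x \<in> U \<inter> E n \<longleftrightarrow> x \<in> B" for n
    proof (rule open_baire_version_finite)
      show "open (U \<inter> E n)"
        using Basic EL(2) by auto
      have "emeasure \<mu> (U \<inter> E n) \<le> emeasure \<mu> (L n)"
        using EL(3,4) by (intro emeasure_mono compact_in_sets) auto
      also have "\<dots> < \<infinity>"
        using emeasure_compact_finite EL(4) by auto
      finally show "emeasure \<mu> (U \<inter> E n) < \<infinity>" .
    qed
    then obtain B where B: "\<And>n. B n \<in> sets baire" "\<And>n. AE x in \<mu>. x \<in> U \<inter> E n \<longleftrightarrow> x \<in> B n"
      by metis
    have "AE x in \<mu>. \<forall>n. x \<in> U \<inter> E n \<longleftrightarrow> x \<in> B n"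
      using B(2) by (simp add: AE_all_countable)
    then have "AE x in \<mu>. x \<in> U \<longleftrightarrow> x \<in> (\<Union>n. B n)"
    proof eventually_elim
      case (elim x)
      have "x \<in> (\<Union>n. E n)"
        using EL(5) by simp
      then show ?case
        using elim by auto
    qed
    then show ?case
      using B(1) by (intro bexI[of _ "\<Union>n. B n"]) auto
  next
    case Empty
    show ?case
      by (intro bexI[of _ "{}"]) auto
  next
    case (Compl A)
    then obtain B where "B \<in> sets baire" "AE x in \<mu>. x \<in> A \<longleftrightarrow> x \<in> B"
      by auto
    then show ?case
      using sets.compl_sets[of B baire] by (intro bexI[of _ "UNIV - B"]) auto
  next
    case (Union A)
    then obtain B where B: "\<And>i. B i \<in> sets baire" "\<And>i :: nat. AE x in \<mu>. x \<in> A i \<longleftrightarrow> x \<in> B i"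
      by metis
    have "AE x in \<mu>. \<forall>i. x \<in> A i \<longleftrightarrow> x \<in> B i"
      using B(2) by (simp add: AE_all_countable)
    then have "AE x in \<mu>. x \<in> (\<Union>i. A i) \<longleftrightarrow> x \<in> (\<Union>i. B i)"
      by eventually_elim auto
    then show ?case
      using B(1) by (intro bexI[of _ "\<Union>i. B i"]) auto
  qed
qed

lemma borel_fun_baire_version_ennreal:
  fixes f :: "'a \<Rightarrow> ennreal"
  assumes "f \<in> borel_measurable borel"
  shows "\<exists>g\<in>borel_measurable baire. AE x in \<mu>. f x = g x"
  using assms
proof (induction rule: borel_measurable_induct)
  case (cong f g)
  then show ?case by (simp add: fun_eq_iff)
next
  case (set A)
  then obtain B where B: "B \<in> sets baire" "AE x in \<mu>. x \<in> A \<longleftrightarrow> x \<in> B"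
    using borel_baire_version by blast
  then show ?case
    by (intro bexI[of _ "indicator B"]) (auto simp: indicator_def elim!: eventually_mono)
next
  case (mult u c)
  then obtain g where "g \<in> borel_measurable baire" "AE x in \<mu>. u x = g x" by blast
  then show ?case
    by (intro bexI[of _ "\<lambda>x. c * g x"]) auto
next
  case (add u v)
  then obtain g h where "g \<in> borel_measurable baire" "AE x in \<mu>. u x = g x"
    "h \<in> borel_measurable baire" "AE x in \<mu>. v x = h x" by blast
  then show ?case
    by (intro bexI[of _ "\<lambda>x. h x + g x"]) auto
next
  case (seq U)
  then obtain g where g: "\<And>i. g i \<in> borel_measurable baire" "\<And>i. AE x in \<mu>. U i x = g i x"
    by metis
  have "AE x in \<mu>. \<forall>i. U i x = g i x"
    using g(2) by (simp add: AE_all_countable)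
  then have "AE x in \<mu>. (SUP i. U i) x = (SUP i. g i x)"
    by eventually_elim (simp add: image_image)
  then show ?case
    using g(1) by (intro bexI[of _ "\<lambda>x. SUP i. g i x"]) auto
qed

lemma borel_fun_baire_version:
  fixes f :: "'a \<Rightarrow> real"
  assumes f: "f \<in> borel_measurable \<mu>"
  obtains g where "g \<in> borel_measurable baire" "AE x in \<mu>. f x = g x"
proof -
  have [measurable]: "f \<in> borel_measurable borel"
    using f unfolding measurable_cong_sets[OF sets_borel refl] .
  obtain g1 where g1: "g1 \<in> borel_measurable baire" "AE x in \<mu>. ennreal (f x) = g1 x"
    using borel_fun_baire_version_ennreal[of "\<lambda>x. ennreal (f x)"] by auto
  obtain g2 where g2: "g2 \<in> borel_measurable baire" "AE x in \<mu>. ennreal (- f x) = g2 x"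
    using borel_fun_baire_version_ennreal[of "\<lambda>x. ennreal (- f x)"] by auto
  note [measurable] = g1(1) g2(1)
  have "AE x in \<mu>. f x = enn2real (g1 x) - enn2real (g2 x)"
    using g1(2) g2(2)
  proof eventually_elim
    case (elim x)
    then show ?case
      by (cases "f x \<ge> 0") (auto simp flip: elim simp: ennreal_neg)
  qed
  then show ?thesis
    by (intro that[of "\<lambda>x. enn2real (g1 x) - enn2real (g2 x)"]) measurable
qed

end

section \<open>Disintegration along the cosets of the subgroup\<close>

locale unimodular_pair =
  G: unimodular_haar_subgroup S UNIV S \<mu> + H: unimodular_haar_subgroup S H T \<nu>
  for S H T :: "'a::{topological_group_add, t2_space} set" and \<mu> \<nu>
begin

sublocale G: haar_group S \<mu>
  by unfold_locales

lemma pair_sigma_finite: "pair_sigma_finite \<nu> \<mu>"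
  by (intro pair_sigma_finite.intro H.sigma_finite G.sigma_finite)

lemma measurable_fst_borel: "fst \<in> \<nu> \<Otimes>\<^sub>M N \<rightarrow>\<^sub>M borel"
  by (rule measurable_compose[OF measurable_fst H.measurable_ident_haar])

lemma measurable_snd_baire: "snd \<in> N \<Otimes>\<^sub>M \<mu> \<rightarrow>\<^sub>M baire"
  by (rule measurable_compose[OF measurable_snd G.ident_baire])

lemma measurable_uminus_borel:
  fixes u :: "'b \<Rightarrow> 'a"
  assumes "u \<in> M \<rightarrow>\<^sub>M borel" shows "(\<lambda>z. - u z) \<in> M \<rightarrow>\<^sub>M borel"
  by (rule measurable_compose[OF assms borel_measurable_continuous_onI]) (intro continuous_intros)

text \<open>A Bruhat function: its integral over every coset is one. Of the countably many relatively
  compact open sets covering \<open>G\<close>, take the first that meets the coset in positive measure.\<close>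

lemma bruhat_function:
  "\<exists>\<phi> :: 'a \<Rightarrow> ennreal. \<phi> \<in> borel_measurable baire \<and> (\<forall>g. (\<integral>\<^sup>+ h. \<phi> (- h + g) \<partial>\<nu>) = 1)"
proof -
  obtain E L :: "nat \<Rightarrow> 'a set" where EL: "\<And>n. E n \<in> sets baire" "\<And>n. open (E n)" "\<And>n. E n \<subseteq> L n"
    "\<And>n. compact (L n)" "(\<Union>n. E n) = UNIV"
    using G.baire_exhaustion by metis
  define m where "m n g = (\<integral>\<^sup>+ h. indicator (E n) (- h + g) \<partial>\<nu>)" for n g
  have ind: "(indicator (E n) :: 'a \<Rightarrow> ennreal) \<in> borel_measurable baire" for n
    using EL(1) by auto
  have [measurable]: "m n \<in> borel_measurable baire" for n
    unfolding m_def
    by (rule sigma_finite_measure.borel_measurable_nn_integral[OF H.sigma_finite])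
       (auto simp: split_beta' intro!: measurable_compose[OF _ ind] G.measurable_add_baire
          measurable_uminus_borel measurable_compose[OF measurable_snd H.measurable_ident_haar])
  have sec: "(\<lambda>h. indicator (E n) (- h + g) :: ennreal) \<in> borel_measurable \<nu>" for n g
    by (rule measurable_compose[OF _ ind])
       (intro G.measurable_add_baire measurable_uminus_borel H.measurable_ident_haar, simp)
  \<comment> \<open>hence the first index of positive measure depends on the coset only\<close>
  have m_inv: "m n (- k + g) = m n g" if "k \<in> H" for n k g
  proof -
    have "m n g = (\<integral>\<^sup>+ h. indicator (E n) (- (- k + h) + (- k + g)) \<partial>\<nu>)"
      unfolding m_def by (simp add: minus_add add.assoc del: add_uminus_conv_diff)
    also have "\<dots> = m n (- k + g)"
      unfolding m_def using that sec[of n "- k + g"]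
      by (intro H.nn_integral_left_translation) auto
    finally show ?thesis ..
  qed
  \<comment> \<open>any two \<open>h\<close> contributing to \<open>m n g\<close> differ by an element of \<open>L n - L n\<close>\<close>
  have m_fin: "m n g < \<infinity>" for n g
  proof -
    define P where "P = H \<inter> {a + b | a b. a \<in> L n \<and> b \<in> uminus ` L n}"
    have "compact (uminus ` L n)"
      by (intro compact_continuous_image EL continuous_intros)
    then have P: "compact P" "P \<subseteq> H"
      unfolding P_def using H.closed EL(4) by (auto intro!: closed_Int_compact compact_set_sum)
    show ?thesis
    proof (cases "\<exists>h\<in>H. - h + g \<in> E n")
      case False
      then have "m n g = (\<integral>\<^sup>+ h. 0 \<partial>\<nu>)"
        unfolding m_def by (intro nn_integral_cong) auto
      then show ?thesis by simp
    next
      case True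
      then obtain k where k: "k \<in> H" "- k + g \<in> E n" by blast
      have "m n g \<le> (\<integral>\<^sup>+ h. indicator P (- k + h) \<partial>\<nu>)"
        unfolding m_def
      proof (rule nn_integral_mono)
        fix h assume "h \<in> space \<nu>"
        then have h: "h \<in> H" by simp
        have "- k + h \<in> P" if "- h + g \<in> E n"
        proof -
          have "- k + h = (- k + g) + - (- h + g)"
            by (simp add: minus_add add.assoc del: add_uminus_conv_diff)
          then show ?thesis
            unfolding P_def using h k that EL(3) by (blast intro: H.add_in H.uminus_in)
        qed
        then show "indicator (E n) (- h + g) \<le> (indicator P (- k + h) :: ennreal)"
          by (auto simp: indicator_def)
      qed
      also have "\<dots> = (\<integral>\<^sup>+ h. indicator P h \<partial>\<nu>)"
        using k P by (intro H.nn_integral_left_translation) (auto intro!: borel_measurable_indicator H.compact_in_sets)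
      also have "\<dots> = emeasure \<nu> P"
        using P by (simp add: H.compact_in_sets)
      also have "\<dots> < \<infinity>"
        using P by (intro H.emeasure_compact_finite)
      finally show ?thesis .
    qed
  qed
  have m_pos: "\<exists>n. m n g > 0" for g
  proof (rule ccontr)
    assume "\<not> ?thesis"
    then have "(\<integral>\<^sup>+ h. indicator (E n) (- h + g) \<partial>\<nu>) = 0" for n
      by (simp add: m_def)
    then have "AE h in \<nu>. (indicator (E n) (- h + g) :: ennreal) = 0" for n
      by (subst (asm) nn_integral_0_iff_AE) (auto intro: sec)
    then have "AE h in \<nu>. \<forall>n. (indicator (E n) (- h + g) :: ennreal) = 0"
      by (simp add: AE_all_countable)
    then have "AE h in \<nu>. False"
    proof eventually_elim
      case (elim h)
      have "- h + g \<in> (\<Union>n. E n)"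
        using EL(5) by simp
      then obtain n where "- h + g \<in> E n" by auto
      then have "(indicator (E n) (- h + g) :: ennreal) = 1" by simp
      then show ?case using elim by (metis zero_neq_one)
    qed
    then show False
      using H.emeasure_space_pos by (simp add: eventually_False ae_filter_eq_bot_iff)
  qed
  define i where "i g = (LEAST n. m n g > 0)" for g
  have i_pos: "m (i g) g > 0" for g
    unfolding i_def using m_pos[of g] by (rule LeastI_ex)
  have i_inv: "i (- k + g) = i g" if "k \<in> H" for k g
    unfolding i_def using m_inv[OF that] by simp
  have [measurable]: "i \<in> baire \<rightarrow>\<^sub>M count_space UNIV"
    unfolding i_def by measurable
  define \<phi> where "\<phi> g = indicator (E (i g)) g / m (i g) g" for g
  show ?thesis
  proof (intro exI[of _ \<phi>] conjI allI)
    show "\<phi> \<in> borel_measurable baire"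
      unfolding \<phi>_def
    proof (rule measurable_compose_countable)
      show "(\<lambda>x. indicator (E n) x / m n x) \<in> borel_measurable baire" for n
        using ind[of n] by measurable
    qed measurable
    fix g
    have "(\<integral>\<^sup>+ h. \<phi> (- h + g) \<partial>\<nu>) = (\<integral>\<^sup>+ h. indicator (E (i g)) (- h + g) / m (i g) g \<partial>\<nu>)"
      by (intro nn_integral_cong) (simp add: \<phi>_def i_inv m_inv)
    also have "\<dots> = m (i g) g / m (i g) g"
      using sec[of "i g" g] unfolding m_def by (subst nn_integral_divide) auto
    also have "\<dots> = 1"
      using i_pos[of g] m_fin[of "i g" g] by (intro ennreal_divide_self) auto
    finally show "(\<integral>\<^sup>+ h. \<phi> (- h + g) \<partial>\<nu>) = 1" .
  qed
qed

text \<open>Weil's formula, with the measure on the coset space replaced by a Bruhat function: by left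
  invariance of \<open>\<mu>\<close> both sides are integrals of \<open>\<phi> (- h + g) * F g\<close> over \<open>H \<times> G\<close>.\<close>

lemma disintegration:
  "\<exists>\<phi> :: 'a \<Rightarrow> ennreal. \<phi> \<in> borel_measurable baire \<and>
    (\<forall>F :: 'a \<Rightarrow> ennreal. F \<in> borel_measurable baire \<longrightarrow>
      (\<integral>\<^sup>+ g. \<phi> g * (\<integral>\<^sup>+ h. F (h + g) \<partial>\<nu>) \<partial>\<mu>) = (\<integral>\<^sup>+ g. F g \<partial>\<mu>))"
proof -
  interpret pair_sigma_finite \<nu> \<mu>
    by (rule pair_sigma_finite)
  obtain \<phi> :: "'a \<Rightarrow> ennreal" where \<phi>: "\<phi> \<in> borel_measurable baire" "\<And>g. (\<integral>\<^sup>+ h. \<phi> (- h + g) \<partial>\<nu>) = 1"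
    using bruhat_function by metis
  have "(\<integral>\<^sup>+ g. \<phi> g * (\<integral>\<^sup>+ h. F (h + g) \<partial>\<nu>) \<partial>\<mu>) = (\<integral>\<^sup>+ g. F g \<partial>\<mu>)"
    if F: "F \<in> borel_measurable baire" for F :: "'a \<Rightarrow> ennreal"
  proof -
    have [measurable]: "(\<lambda>z. F (fst z + snd z)) \<in> borel_measurable (\<nu> \<Otimes>\<^sub>M \<mu>)"
      "(\<lambda>z. \<phi> (- fst z + snd z)) \<in> borel_measurable (\<nu> \<Otimes>\<^sub>M \<mu>)"
      by (auto intro!: measurable_compose[OF _ F] measurable_compose[OF _ \<phi>(1)] G.measurable_add_baire
          measurable_uminus_borel measurable_fst_borel measurable_snd_baire)
    have [measurable]: "\<phi> \<in> borel_measurable \<mu>" "F \<in> borel_measurable \<mu>"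
      using \<phi>(1) F by (auto intro: G.baire_measurable)
    have sec: "(\<lambda>h. F (h + g)) \<in> borel_measurable \<nu>" "(\<lambda>h. \<phi> (- h + g)) \<in> borel_measurable \<nu>" for g
      by (auto intro!: measurable_compose[OF _ F] measurable_compose[OF _ \<phi>(1)] G.measurable_add_baire
          measurable_uminus_borel H.measurable_ident_haar)
    have sec': "(\<lambda>g. \<phi> (- h + g)) \<in> borel_measurable \<mu>" for h
      by (auto intro!: measurable_compose[OF _ \<phi>(1)] G.measurable_add_baire G.ident_baire)
    have "(\<integral>\<^sup>+ g. \<phi> g * (\<integral>\<^sup>+ h. F (h + g) \<partial>\<nu>) \<partial>\<mu>) = (\<integral>\<^sup>+ g. (\<integral>\<^sup>+ h. \<phi> g * F (h + g) \<partial>\<nu>) \<partial>\<mu>)"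
      by (intro nn_integral_cong nn_integral_cmult[symmetric] sec)
    also have "\<dots> = (\<integral>\<^sup>+ h. (\<integral>\<^sup>+ g. \<phi> g * F (h + g) \<partial>\<mu>) \<partial>\<nu>)"
      by (rule Fubini') (simp add: case_prod_beta)
    also have "\<dots> = (\<integral>\<^sup>+ h. (\<integral>\<^sup>+ g. \<phi> (- h + g) * F g \<partial>\<mu>) \<partial>\<nu>)"
    proof (rule nn_integral_cong)
      fix h
      have "(\<integral>\<^sup>+ g. \<phi> (- h + (h + g)) * F (h + g) \<partial>\<mu>) = (\<integral>\<^sup>+ g. \<phi> (- h + g) * F g \<partial>\<mu>)"
        using sec'[of h] by (intro G.nn_integral_left_translation) auto
      then show "(\<integral>\<^sup>+ g. \<phi> g * F (h + g) \<partial>\<mu>) = (\<integral>\<^sup>+ g. \<phi> (- h + g) * F g \<partial>\<mu>)"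
        by simp
    qed
    also have "\<dots> = (\<integral>\<^sup>+ g. (\<integral>\<^sup>+ h. \<phi> (- h + g) * F g \<partial>\<nu>) \<partial>\<mu>)"
      by (rule Fubini'[symmetric]) (simp add: case_prod_beta)
    also have "\<dots> = (\<integral>\<^sup>+ g. F g \<partial>\<mu>)"
      by (intro nn_integral_cong) (simp add: nn_integral_multc sec \<phi>(2))
    finally show ?thesis .
  qed
  then show ?thesis
    using \<phi>(1) by blast
qed

end

section \<open>Averaging the displacement over the subgroup\<close>

context haar_subgroup
begin

lemma displacement_decomposition:
  fixes f :: "'a \<Rightarrow> real"
  shows "(\<lambda>y. f y - left_translate t f y) =
    (\<lambda>y. (f y - left_translate (t + u) f y) + - left_translate t (\<lambda>y. f y - left_translate u f y) y)"
  by (auto simp: left_translate_def minus_add add.assoc fun_eq_iff simp del: add_uminus_conv_diff)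

lemma displacement_measurable:
  assumes "f \<in> borel_measurable \<nu>" "u \<in> K"
  shows "(\<lambda>y. f y - left_translate u f y) \<in> borel_measurable \<nu>"
  by (intro borel_measurable_diff left_translate_measurable assms)

lemma pow_integral_displacement_le:
  assumes f: "f \<in> borel_measurable \<nu>" and tu: "t \<in> K" "u \<in> K" and q: "q > 0"
  shows "pow_integral \<nu> q (\<lambda>y. f y - left_translate t f y) \<le> ennreal (2 powr q) *
    (pow_integral \<nu> q (\<lambda>y. f y - left_translate (t + u) f y)
      + pow_integral \<nu> q (\<lambda>y. f y - left_translate u f y))"
proof -
  let ?d = "\<lambda>y. f y - left_translate u f y"
  have d: "?d \<in> borel_measurable \<nu>" "(\<lambda>y. f y - left_translate (t + u) f y) \<in> borel_measurable \<nu>"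
    using displacement_measurable[OF f] tu add_in by auto
  have "pow_integral \<nu> q (\<lambda>y. f y - left_translate t f y) \<le> ennreal (2 powr q) *
    (pow_integral \<nu> q (\<lambda>y. f y - left_translate (t + u) f y)
      + pow_integral \<nu> q (\<lambda>y. - left_translate t ?d y))"
    by (subst displacement_decomposition[of f t u])
       (intro pow_integral_add_le d borel_measurable_uminus left_translate_measurable tu q)
  also have "pow_integral \<nu> q (\<lambda>y. - left_translate t ?d y) = pow_integral \<nu> q (\<lambda>y. ?d (- t + y))"
    by (simp only: pow_integral_def abs_minus_cancel left_translate_def)
  also have "\<dots> = pow_integral \<nu> q ?d"
    using tu by (intro pow_integral_distr measurable_left_translation d(1) distr_left_translation) auto
  finally show ?thesis .
qed

lemma Lp_norm_displacement_le:
  assumes f: "f \<in> borel_measurable \<nu>" and tu: "t \<in> K" "u \<in> K" and p: "1 \<le> p"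
  shows "Lp_norm \<nu> p (\<lambda>y. f y - left_translate t f y) \<le>
    4 * (Lp_norm \<nu> p (\<lambda>y. f y - left_translate (t + u) f y)
      + Lp_norm \<nu> p (\<lambda>y. f y - left_translate u f y))"
proof -
  let ?d = "\<lambda>y. f y - left_translate u f y"
  have d: "?d \<in> borel_measurable \<nu>" "(\<lambda>y. f y - left_translate (t + u) f y) \<in> borel_measurable \<nu>"
    using displacement_measurable[OF f] tu add_in by auto
  have "Lp_norm \<nu> p (\<lambda>y. f y - left_translate t f y) \<le>
    4 * (Lp_norm \<nu> p (\<lambda>y. f y - left_translate (t + u) f y)
      + Lp_norm \<nu> p (\<lambda>y. - left_translate t ?d y))"
    by (subst displacement_decomposition[of f t u])
       (intro Lp_norm_add_le d borel_measurable_uminus left_translate_measurable tu p)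
  then show ?thesis
    by (simp add: Lp_norm_minus Lp_norm_left_translate[OF d(1) tu(1)])
qed

text \<open>A displacement by \<open>t\<close> is a displacement by \<open>t + u\<close> corrected by one by \<open>u\<close>; letting \<open>u\<close>
  range over a ball \<open>V\<close> of positive measure bounds a supremum over \<open>T\<close> by an average over
  \<open>V \<union> (T + V)\<close>. An average, unlike a supremum, can be integrated over the cosets.\<close>

lemma sup_displacement_le_average:
  "\<exists>Q D. compact Q \<and> Q \<subseteq> K \<and> D < \<infinity> \<and>
    (\<forall>F t. F \<in> borel_measurable \<nu> \<longrightarrow>
       (\<lambda>u. pow_integral \<nu> q (\<lambda>y. F y - left_translate u F y)) \<in> borel_measurable \<nu> \<longrightarrow> q > 0 \<longrightarrow> t \<in> T \<longrightarrow>
       pow_integral \<nu> q (\<lambda>y. F y - left_translate t F y) \<le>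
         D * (\<integral>\<^sup>+ u. indicator Q u * pow_integral \<nu> q (\<lambda>y. F y - left_translate u F y) \<partial>\<nu>)) \<and>
    (\<forall>F t c. F \<in> borel_measurable \<nu> \<longrightarrow> t \<in> T \<longrightarrow>
       (AE u in \<nu>. u \<in> Q \<longrightarrow> Lp_norm \<nu> \<infinity> (\<lambda>y. F y - left_translate u F y) \<le> c) \<longrightarrow>
       Lp_norm \<nu> \<infinity> (\<lambda>y. F y - left_translate t F y) \<le> 8 * c)"
proof -
  obtain n where n: "emeasure \<nu> (set_power T n) > 0" "emeasure \<nu> (set_power T n) < \<infinity>"
    "set_power T n \<in> sets \<nu>"
    by (rule ball_positive_measure)
  define V where "V = set_power T n"
  define Q where "Q = V \<union> {t + v | t v. t \<in> T \<and> v \<in> V}"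
  define D where "D = ennreal (2 powr q) * 2 / emeasure \<nu> V"
  have V: "compact V" "V \<subseteq> K" "V \<in> sets \<nu>" "emeasure \<nu> V > 0" "emeasure \<nu> V < \<infinity>"
    using n set_power_T_subset by (auto simp: V_def compact_set_power_T)
  have Q: "compact Q" "Q \<subseteq> K"
    using V(1,2) T_subset by (auto simp: Q_def intro!: compact_Un compact_set_sum compact_T add_in)
  have [measurable]: "V \<in> sets \<nu>" "Q \<in> sets \<nu>"
    using V(3) compact_in_sets[OF Q] by auto
  have "D < \<infinity>"
    using V(4) by (auto simp: D_def ennreal_divide_eq_top_iff ennreal_mult_eq_top_iff less_top[symmetric])
  moreover have "pow_integral \<nu> q (\<lambda>y. F y - left_translate t F y) \<le>
         D * (\<integral>\<^sup>+ u. indicator Q u * pow_integral \<nu> q (\<lambda>y. F y - left_translate u F y) \<partial>\<nu>)"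
    if F: "F \<in> borel_measurable \<nu>" and q: "q > 0" and t: "t \<in> T"
      and e: "(\<lambda>u. pow_integral \<nu> q (\<lambda>y. F y - left_translate u F y)) \<in> borel_measurable \<nu>" for F t
  proof -
    define e where "e u = pow_integral \<nu> q (\<lambda>y. F y - left_translate u F y)" for u
    have [measurable]: "e \<in> borel_measurable \<nu>"
      using e unfolding e_def[abs_def] .
    have tK: "t \<in> K"
      using t T_subset by auto
    have tr [measurable]: "(\<lambda>u. t + u) \<in> \<nu> \<rightarrow>\<^sub>M \<nu>" "(\<lambda>u. - t + u) \<in> \<nu> \<rightarrow>\<^sub>M \<nu>"
      using measurable_left_translation tK by auto
    let ?I = "\<integral>\<^sup>+ u. indicator Q u * e u \<partial>\<nu>"
    have "e t * emeasure \<nu> V = (\<integral>\<^sup>+ u. e t * indicator V u \<partial>\<nu>)"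
      by (simp add: nn_integral_cmult_indicator)
    also have "\<dots> \<le> (\<integral>\<^sup>+ u. ennreal (2 powr q) * (indicator V u * e (t + u) + indicator V u * e u) \<partial>\<nu>)"
    proof (rule nn_integral_mono)
      fix u assume "u \<in> space \<nu>"
      then have "e t \<le> ennreal (2 powr q) * (e (t + u) + e u)"
        unfolding e_def by (intro pow_integral_displacement_le F tK q) simp
      then show "e t * indicator V u \<le> ennreal (2 powr q) * (indicator V u * e (t + u) + indicator V u * e u)"
        by (auto simp: indicator_def)
    qed
    also have "\<dots> = ennreal (2 powr q) * ((\<integral>\<^sup>+ u. indicator V u * e (t + u) \<partial>\<nu>) + (\<integral>\<^sup>+ u. indicator V u * e u \<partial>\<nu>))"
      by (simp add: nn_integral_cmult nn_integral_add)
    also have "(\<integral>\<^sup>+ u. indicator V u * e (t + u) \<partial>\<nu>) = (\<integral>\<^sup>+ u. indicator V (- t + (t + u)) * e (t + u) \<partial>\<nu>)"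
      by simp
    also have "\<dots> = (\<integral>\<^sup>+ u. indicator V (- t + u) * e u \<partial>\<nu>)"
      by (rule nn_integral_left_translation[OF tK]) measurable
    also have "ennreal (2 powr q) * (\<dots> + (\<integral>\<^sup>+ u. indicator V u * e u \<partial>\<nu>))
      \<le> ennreal (2 powr q) * (?I + ?I)"
    proof (intro mult_left_mono add_mono nn_integral_mono mult_right_mono)
      fix u
      have "u \<in> Q" if "- t + u \<in> V"
      proof -
        have "u = t + (- t + u)" by (simp add: add.assoc[symmetric])
        then show ?thesis
          using that t unfolding Q_def by blast
      qed
      then show "indicator V (- t + u) \<le> (indicator Q u :: ennreal)"
        by (auto simp: indicator_def)
      show "indicator V u \<le> (indicator Q u :: ennreal)"
        by (auto simp: indicator_def Q_def)
    qed auto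
    also have "\<dots> = D * ?I * emeasure \<nu> V"
    proof -
      have "D * emeasure \<nu> V = ennreal (2 powr q) * 2"
        unfolding D_def ennreal_divide_times using V(4,5) by simp
      have "D * ?I * emeasure \<nu> V = (D * emeasure \<nu> V) * ?I"
        by (simp only: ac_simps)
      then show ?thesis
        by (simp add: \<open>D * emeasure \<nu> V = _\<close> mult_2 mult.assoc)
    qed
    finally have "e t * emeasure \<nu> V \<le> D * ?I * emeasure \<nu> V" .
    then show ?thesis
      using V(4,5) ennreal_mult_le_mult_iff[of "emeasure \<nu> V" "e t" "D * ?I"]
      unfolding e_def[symmetric] by (auto simp: mult.commute[of "emeasure \<nu> V"])
  qed
  moreover have "Lp_norm \<nu> \<infinity> (\<lambda>y. F y - left_translate t F y) \<le> 8 * c"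
    if F: "F \<in> borel_measurable \<nu>" and t: "t \<in> T"
      and ae: "AE u in \<nu>. u \<in> Q \<longrightarrow> Lp_norm \<nu> \<infinity> (\<lambda>y. F y - left_translate u F y) \<le> c" for F t c
  proof -
    define e where "e u = Lp_norm \<nu> \<infinity> (\<lambda>y. F y - left_translate u F y)" for u
    have tK: "t \<in> K"
      using t T_subset by auto
    \<comment> \<open>each of the two conditions fails for a null set of \<open>u \<in> V\<close> only\<close>
    have "\<exists>u\<in>V. e u \<le> c \<and> e (t + u) \<le> c"
    proof (rule ccontr)
      assume *: "\<not> ?thesis"
      have "AE u in \<nu>. u \<notin> V"
        using ae AE_left_translation[OF tK ae]
      proof eventually_elim
        case (elim u)
        show ?case
        proof
          assume u: "u \<in> V"
          then have "u \<in> Q" "t + u \<in> Q"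
            using t by (auto simp: Q_def)
          then show False
            using elim * u by (auto simp: e_def)
        qed
      qed
      then have "V \<in> null_sets \<nu>"
        using AE_iff_null_sets[OF V(3)] by simp
      then show False
        using V(4) by auto
    qed
    then obtain u where u: "u \<in> V" "e u \<le> c" "e (t + u) \<le> c" by blast
    have "e t \<le> 4 * (e (t + u) + e u)"
      unfolding e_def using u(1) V(2) by (intro Lp_norm_displacement_le F tK) auto
    also have "\<dots> \<le> 4 * (c + c)"
      using u by (intro mult_left_mono add_mono) auto
    also have "\<dots> = 8 * c"
      by (simp add: mult_2[symmetric] mult.assoc[symmetric])
    finally show ?thesis
      by (simp add: e_def)
  qed
  ultimately show ?thesis
    using Q by blast
qed

end

section \<open>Comparison of a group with its cosets\<close>

definition slice :: "('a::group_add \<Rightarrow> 'b) \<Rightarrow> 'a \<Rightarrow> 'a \<Rightarrow> 'b" where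
  "slice f g = (\<lambda>h. f (h + g))"

context unimodular_pair
begin

lemma slice_measurable:
  assumes "f \<in> baire \<rightarrow>\<^sub>M N" shows "slice f g \<in> \<nu> \<rightarrow>\<^sub>M N"
  unfolding slice_def
  by (rule measurable_compose[OF _ assms]) (auto intro!: G.measurable_add_baire H.measurable_ident_haar)

text \<open>Integrates, over all cosets, an average over \<open>u\<close> of a quantity on the coset. For finite exponents \<open>\<Psi> u\<close> will be
  the power of a displacement by \<open>u\<close>, for \<open>p = \<infinity>\<close> the indicator of the set where it is too large.\<close>

lemma disintegration_parametric:
  assumes \<phi>: "\<phi> \<in> borel_measurable baire"
    and dis: "\<And>F :: 'a \<Rightarrow> ennreal. F \<in> borel_measurable baire \<Longrightarrow>
      (\<integral>\<^sup>+ g. \<phi> g * (\<integral>\<^sup>+ h. F (h + g) \<partial>\<nu>) \<partial>\<mu>) = (\<integral>\<^sup>+ g. F g \<partial>\<mu>)"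
    and \<Psi>: "case_prod \<Psi> \<in> borel_measurable (\<nu> \<Otimes>\<^sub>M baire)"
  shows "(\<integral>\<^sup>+ g. \<phi> g * (\<integral>\<^sup>+ u. (\<integral>\<^sup>+ h. \<Psi> u (h + g) \<partial>\<nu>) \<partial>\<nu>) \<partial>\<mu>) = (\<integral>\<^sup>+ u. (\<integral>\<^sup>+ g. \<Psi> u g \<partial>\<mu>) \<partial>\<nu>)"
    and "(\<lambda>u. \<integral>\<^sup>+ h. \<Psi> u (h + g) \<partial>\<nu>) \<in> borel_measurable \<nu>"
    and "(\<lambda>g. \<integral>\<^sup>+ u. (\<integral>\<^sup>+ h. \<Psi> u (h + g) \<partial>\<nu>) \<partial>\<nu>) \<in> borel_measurable \<mu>"
proof -
  interpret pair_sigma_finite \<nu> \<mu>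
    by (rule pair_sigma_finite)
  let ?J = "\<lambda>u g. \<integral>\<^sup>+ h. \<Psi> u (h + g) \<partial>\<nu>"
  have J: "case_prod ?J \<in> borel_measurable (\<nu> \<Otimes>\<^sub>M \<mu>)"
    unfolding split_beta'
  proof (rule sigma_finite_measure.borel_measurable_nn_integral[OF H.sigma_finite], unfold split_beta')
    have "(\<lambda>w. (fst (fst w), snd w + snd (fst w))) \<in> (\<nu> \<Otimes>\<^sub>M \<mu>) \<Otimes>\<^sub>M \<nu> \<rightarrow>\<^sub>M \<nu> \<Otimes>\<^sub>M baire"
      by (intro measurable_Pair G.measurable_add_baire measurable_compose[OF measurable_snd H.measurable_ident_haar]
          measurable_compose[OF measurable_fst measurable_snd_baire]) measurable
    from measurable_compose[OF this \<Psi>]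
    show "(\<lambda>w. \<Psi> (fst (fst w)) (snd w + snd (fst w))) \<in> borel_measurable ((\<nu> \<Otimes>\<^sub>M \<mu>) \<Otimes>\<^sub>M \<nu>)"
      by simp
  qed
  show J1: "(\<lambda>u. ?J u g) \<in> borel_measurable \<nu>" for g
    using measurable_Pair2'[of g \<mu> \<nu>] measurable_compose[OF _ J, of "\<lambda>u. (u, g)" \<nu>] by simp
  show J2: "(\<lambda>g. \<integral>\<^sup>+ u. ?J u g \<partial>\<nu>) \<in> borel_measurable \<mu>"
    by (rule sigma_finite_measure.borel_measurable_nn_integral[OF H.sigma_finite])
       (use measurable_compose[OF measurable_pair_swap' J] in \<open>simp add: split_beta'\<close>)
  have [measurable]: "\<phi> \<in> borel_measurable \<mu>"
    by (rule G.baire_measurable[OF \<phi>])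
  have "(\<integral>\<^sup>+ g. \<phi> g * (\<integral>\<^sup>+ u. ?J u g \<partial>\<nu>) \<partial>\<mu>) = (\<integral>\<^sup>+ g. (\<integral>\<^sup>+ u. \<phi> g * ?J u g \<partial>\<nu>) \<partial>\<mu>)"
    by (intro nn_integral_cong nn_integral_cmult[symmetric] J1)
  also have "\<dots> = (\<integral>\<^sup>+ u. (\<integral>\<^sup>+ g. \<phi> g * ?J u g \<partial>\<mu>) \<partial>\<nu>)"
    by (rule Fubini') (use J in \<open>simp add: split_beta'\<close>)
  also have "\<dots> = (\<integral>\<^sup>+ u. (\<integral>\<^sup>+ g. \<Psi> u g \<partial>\<mu>) \<partial>\<nu>)"
  proof (rule nn_integral_cong)
    fix u assume "u \<in> space \<nu>"
    then have "(\<lambda>x. (u, x)) \<in> baire \<rightarrow>\<^sub>M \<nu> \<Otimes>\<^sub>M baire"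
      by (rule measurable_Pair1')
    from measurable_compose[OF this \<Psi>] have "\<Psi> u \<in> borel_measurable baire"
      by simp
    then show "(\<integral>\<^sup>+ g. \<phi> g * ?J u g \<partial>\<mu>) = (\<integral>\<^sup>+ g. \<Psi> u g \<partial>\<mu>)"
      by (rule dis)
  qed
  finally show "(\<integral>\<^sup>+ g. \<phi> g * (\<integral>\<^sup>+ u. ?J u g \<partial>\<nu>) \<partial>\<mu>) = (\<integral>\<^sup>+ u. (\<integral>\<^sup>+ g. \<Psi> u g \<partial>\<mu>) \<partial>\<nu>)" .
qed

lemma displacement_joint_measurable:
  fixes f :: "'a \<Rightarrow> real"
  assumes f: "f \<in> borel_measurable baire"
  shows "(\<lambda>(u, x). f x - f (- u + x)) \<in> borel_measurable (\<nu> \<Otimes>\<^sub>M baire)"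
proof -
  have "(\<lambda>z. f (- fst z + snd z)) \<in> borel_measurable (\<nu> \<Otimes>\<^sub>M baire)"
    by (intro measurable_compose[OF _ f] G.measurable_add_baire measurable_uminus_borel
        measurable_fst_borel measurable_snd)
  then show ?thesis
    unfolding split_beta' using f by measurable
qed

text \<open>The constant depends neither on \<open>f\<close> nor on \<open>k\<close>. For \<open>p < \<infinity>\<close> the \<open>p\<close>-th power of the
  hypothesis, with the gradient replaced by an average, is integrated over the cosets. For
  \<open>p = \<infinity>\<close> the same formula transports null sets: almost every slice has almost all its
  displacements bounded by the gradient of \<open>f\<close>. The hypothesis is conditional because only almost
  every slice has finite norm.\<close>

lemma coset_comparison:
  assumes p: "1 \<le> p"
  shows "\<exists>C::real. C > 0 \<and> (\<forall>f k. f \<in> borel_measurable baire \<longrightarrow> Lp_norm \<mu> p f < \<infinity> \<longrightarrow>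
    (\<forall>g. Lp_norm \<nu> p (slice f g) < \<infinity> \<longrightarrow>
       Lp_norm \<nu> p (slice f g) \<le> k * gradient \<nu> T p (slice f g)) \<longrightarrow>
    Lp_norm \<mu> p f \<le> ennreal C * k * gradient \<mu> S p f)"
proof -
  define q where "q = enn2real p"
  obtain \<phi> :: "'a \<Rightarrow> ennreal" where \<phi>: "\<phi> \<in> borel_measurable baire"
    and dis: "\<And>F :: 'a \<Rightarrow> ennreal. F \<in> borel_measurable baire \<Longrightarrow>
      (\<integral>\<^sup>+ g. \<phi> g * (\<integral>\<^sup>+ h. F (h + g) \<partial>\<nu>) \<partial>\<mu>) = (\<integral>\<^sup>+ g. F g \<partial>\<mu>)"
    using disintegration by metis
  have [measurable]: "\<phi> \<in> borel_measurable \<mu>"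
    by (rule G.baire_measurable[OF \<phi>])
  obtain Q D where Q: "compact Q" "Q \<subseteq> H" and D: "D < \<infinity>"
    and avg: "\<And>F t. F \<in> borel_measurable \<nu> \<Longrightarrow>
       (\<lambda>u. pow_integral \<nu> q (\<lambda>y. F y - left_translate u F y)) \<in> borel_measurable \<nu> \<Longrightarrow> q > 0 \<Longrightarrow> t \<in> T \<Longrightarrow>
       pow_integral \<nu> q (\<lambda>y. F y - left_translate t F y) \<le>
         D * (\<integral>\<^sup>+ u. indicator Q u * pow_integral \<nu> q (\<lambda>y. F y - left_translate u F y) \<partial>\<nu>)"
    and avg': "\<And>F t c. F \<in> borel_measurable \<nu> \<Longrightarrow> t \<in> T \<Longrightarrow>
       (AE u in \<nu>. u \<in> Q \<longrightarrow> Lp_norm \<nu> \<infinity> (\<lambda>y. F y - left_translate u F y) \<le> c) \<Longrightarrow>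
       Lp_norm \<nu> \<infinity> (\<lambda>y. F y - left_translate t F y) \<le> 8 * c"
    using H.sup_displacement_le_average[of q] by auto
  have Qs [measurable]: "Q \<in> sets \<nu>"
    by (rule H.compact_in_sets[OF Q])
  obtain N where N: "Q \<subseteq> (\<Union>n\<le>N. set_power S n)"
    by (rule G.compact_subset_balls[OF Q(1)])
  obtain C1 where C1: "C1 > 0" "\<And>f x. f \<in> borel_measurable \<mu> \<Longrightarrow> x \<in> (\<Union>n\<le>N. set_power S n) \<Longrightarrow>
      Lp_norm \<mu> p (\<lambda>y. f y - left_translate x f y) \<le> ennreal C1 * gradient \<mu> S p f"
    using G.displacement_le_gradient[OF p, of N] by blast
  \<comment> \<open>adding \<open>1\<close> makes \<open>C\<close> positive even if \<open>D\<close> or the measure of \<open>Q\<close> vanishes\<close>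
  define C where "C = (if p = \<infinity> then 8 * C1 else enn2real (epow (1 / q) (D * emeasure \<nu> Q)) * C1 + 1)"
  have "C > 0"
    using C1(1) by (auto simp: C_def intro!: add_nonneg_pos mult_nonneg_nonneg)
  moreover have "Lp_norm \<mu> p f \<le> ennreal C * k * gradient \<mu> S p f"
    if f: "f \<in> borel_measurable baire" and fin: "Lp_norm \<mu> p f < \<infinity>"
      and hyp: "\<And>g. Lp_norm \<nu> p (slice f g) < \<infinity> \<Longrightarrow>
       Lp_norm \<nu> p (slice f g) \<le> k * gradient \<nu> T p (slice f g)" for f k
  proof (cases "p = \<infinity>")
    case False
    have q: "q \<ge> 1"
      using p False unfolding q_def by (cases p) auto
    have Lp: "Lp_norm M p F = epow (1 / q) (pow_integral M q F)" for M and F :: "'a \<Rightarrow> real"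
      using False by (simp add: Lp_norm_finite q_def)
    note [measurable] = f G.baire_measurable[OF f] slice_measurable[OF f] displacement_joint_measurable[OF f]
    define \<Psi> where "\<Psi> u x = ennreal (\<bar>f x - f (- u + x)\<bar> powr q)" for u x
    have \<Psi>: "case_prod \<Psi> \<in> borel_measurable (\<nu> \<Otimes>\<^sub>M baire)"
    proof -
      have "(\<lambda>z. ennreal (\<bar>(\<lambda>(u, x). f x - f (- u + x)) z\<bar> powr q)) \<in> borel_measurable (\<nu> \<Otimes>\<^sub>M baire)"
        by measurable
      then show ?thesis
        by (simp add: \<Psi>_def split_beta')
    qed
    then have Q\<Psi>: "(\<lambda>(u, x). indicator Q u * \<Psi> u x) \<in> borel_measurable (\<nu> \<Otimes>\<^sub>M baire)"
      unfolding split_beta' by measurable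
    have slice_\<Psi>: "pow_integral \<nu> q (\<lambda>y. slice f g y - left_translate u (slice f g) y)
      = (\<integral>\<^sup>+ h. \<Psi> u (h + g) \<partial>\<nu>)" for u g
      by (simp add: pow_integral_def \<Psi>_def slice_def left_translate_def add.assoc)
    define R where "R g = (\<integral>\<^sup>+ u. indicator Q u * (\<integral>\<^sup>+ h. \<Psi> u (h + g) \<partial>\<nu>) \<partial>\<nu>)" for g
    have R_eq: "R g = (\<integral>\<^sup>+ u. (\<integral>\<^sup>+ h. indicator Q u * \<Psi> u (h + g) \<partial>\<nu>) \<partial>\<nu>)" for g
      unfolding R_def
    proof (intro nn_integral_cong nn_integral_cmult[symmetric])
      fix u assume "u \<in> space \<nu>"
      then have "(\<lambda>x. (u, x)) \<in> baire \<rightarrow>\<^sub>M \<nu> \<Otimes>\<^sub>M baire"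
        by (rule measurable_Pair1')
      from slice_measurable[OF measurable_compose[OF this \<Psi>], of g]
      show "(\<lambda>h. \<Psi> u (h + g)) \<in> borel_measurable \<nu>"
        by (simp add: slice_def)
    qed
    have [measurable]: "R \<in> borel_measurable \<mu>"
      unfolding R_eq using disintegration_parametric(3)[OF \<phi> dis Q\<Psi>] by simp
    have bound: "pow_integral \<nu> q (slice f g) \<le> epow q k * D * R g"
      if fing: "pow_integral \<nu> q (slice f g) < \<infinity>" for g
    proof -
      have "Lp_norm \<nu> p (slice f g) \<le> k * gradient \<nu> T p (slice f g)"
        using fing by (intro hyp) (simp add: Lp)
      also have "\<dots> \<le> k * epow (1 / q) (D * R g)"
        unfolding gradient_def
      proof (intro mult_left_mono SUP_least)
        fix t assume t: "t \<in> T"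
        have "pow_integral \<nu> q (\<lambda>y. slice f g y - left_translate t (slice f g) y) \<le>
         D * (\<integral>\<^sup>+ u. indicator Q u * pow_integral \<nu> q (\<lambda>y. slice f g y - left_translate u (slice f g) y) \<partial>\<nu>)"
        proof (rule avg[OF _ _ _ t])
          show "(\<lambda>u. pow_integral \<nu> q (\<lambda>y. slice f g y - left_translate u (slice f g) y)) \<in> borel_measurable \<nu>"
            unfolding slice_\<Psi> by (rule disintegration_parametric(2)[OF \<phi> dis \<Psi>])
        qed (use q in auto)
        then show "Lp_norm \<nu> p (\<lambda>y. slice f g y - left_translate t (slice f g) y) \<le> epow (1 / q) (D * R g)"
          unfolding Lp R_def slice_\<Psi> using q by (intro epow_mono) auto
      qed auto
      finally have "epow q (epow (1 / q) (pow_integral \<nu> q (slice f g))) \<le> epow q (k * epow (1 / q) (D * R g))"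
        unfolding Lp using q by (intro epow_mono) auto
      then show ?thesis
        using q by (simp add: epow_mult epow_epow mult.assoc)
    qed
    have mass: "(\<integral>\<^sup>+ g. \<phi> g * pow_integral \<nu> q (slice f g) \<partial>\<mu>) = pow_integral \<mu> q f"
      unfolding pow_integral_def slice_def by (rule dis) measurable
    have "AE g in \<mu>. \<phi> g * pow_integral \<nu> q (slice f g) \<le> epow q k * D * (\<phi> g * R g)"
    proof -
      have [measurable]: "(\<lambda>g. pow_integral \<nu> q (slice f g)) \<in> borel_measurable \<mu>"
      proof -
        have "(\<lambda>(g, h). f (h + g)) \<in> borel_measurable (\<mu> \<Otimes>\<^sub>M \<nu>)"
          unfolding split_beta'
          by (intro measurable_compose[OF _ f] G.measurable_add_baire
              measurable_compose[OF measurable_snd H.measurable_ident_haar]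
              measurable_compose[OF measurable_fst G.ident_baire])
        then show ?thesis
          unfolding pow_integral_def slice_def
          by (intro sigma_finite_measure.borel_measurable_nn_integral[OF H.sigma_finite])
             (simp add: split_beta')
      qed
      have "(\<lambda>g. \<phi> g * pow_integral \<nu> q (slice f g)) \<in> borel_measurable \<mu>"
        by measurable
      moreover have "(\<integral>\<^sup>+ g. \<phi> g * pow_integral \<nu> q (slice f g) \<partial>\<mu>) \<noteq> \<infinity>"
        unfolding mass using fin q by (simp add: Lp less_top)
      ultimately have "AE g in \<mu>. \<phi> g * pow_integral \<nu> q (slice f g) \<noteq> \<infinity>"
        by (intro nn_integral_noteq_infinite)
      then show ?thesis
      proof eventually_elim
        case (elim g)
        show ?case
        proof (cases "\<phi> g = 0")
          case False
          then have "pow_integral \<nu> q (slice f g) < \<infinity>"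
            using elim by (auto simp: less_top ennreal_mult_eq_top_iff)
          from mult_left_mono[OF bound[OF this], of "\<phi> g"] show ?thesis
            by (simp add: ac_simps)
        qed simp
      qed
    qed
    then have "pow_integral \<mu> q f \<le> (\<integral>\<^sup>+ g. epow q k * D * (\<phi> g * R g) \<partial>\<mu>)"
      unfolding mass[symmetric] by (rule nn_integral_mono_AE)
    also have "\<dots> = epow q k * D * (\<integral>\<^sup>+ g. \<phi> g * R g \<partial>\<mu>)"
      by (rule nn_integral_cmult) measurable
    also have "(\<integral>\<^sup>+ g. \<phi> g * R g \<partial>\<mu>) = (\<integral>\<^sup>+ u. (\<integral>\<^sup>+ x. indicator Q u * \<Psi> u x \<partial>\<mu>) \<partial>\<nu>)"
      unfolding R_eq by (rule disintegration_parametric(1)[OF \<phi> dis Q\<Psi>])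
    also have "\<dots> \<le> (\<integral>\<^sup>+ u. epow q (ennreal C1 * gradient \<mu> S p f) * indicator Q u \<partial>\<nu>)"
    proof (rule nn_integral_mono)
      fix u
      show "(\<integral>\<^sup>+ x. indicator Q u * \<Psi> u x \<partial>\<mu>) \<le> epow q (ennreal C1 * gradient \<mu> S p f) * indicator Q u"
      proof (cases "u \<in> Q")
        case True
        have "epow q (epow (1 / q) (pow_integral \<mu> q (\<lambda>y. f y - left_translate u f y)))
          \<le> epow q (ennreal C1 * gradient \<mu> S p f)"
          using q True N C1(2)[of f u] unfolding Lp by (intro epow_mono) auto
        moreover have "pow_integral \<mu> q (\<lambda>y. f y - left_translate u f y) = (\<integral>\<^sup>+ x. \<Psi> u x \<partial>\<mu>)"
          by (simp add: pow_integral_def \<Psi>_def left_translate_def)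
        ultimately show ?thesis
          using q True by (simp add: epow_epow)
      qed simp
    qed
    also have "\<dots> = epow q (ennreal C1 * gradient \<mu> S p f) * emeasure \<nu> Q"
      by (simp add: nn_integral_cmult_indicator)
    finally have "pow_integral \<mu> q f \<le> epow q k * D * (epow q (ennreal C1 * gradient \<mu> S p f) * emeasure \<nu> Q)"
      by (simp add: mult_left_mono)
    then have "Lp_norm \<mu> p f \<le> epow (1 / q) (epow q k * D * (epow q (ennreal C1 * gradient \<mu> S p f) * emeasure \<nu> Q))"
      unfolding Lp using q by (intro epow_mono) auto
    also have "\<dots> = epow (1 / q) (epow q k * epow q (ennreal C1 * gradient \<mu> S p f) * (D * emeasure \<nu> Q))"
      by (simp add: ac_simps)
    also have "\<dots> = k * (ennreal C1 * gradient \<mu> S p f) * epow (1 / q) (D * emeasure \<nu> Q)"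
      using q by (simp only: epow_mult epow_epow) simp
    also have "epow (1 / q) (D * emeasure \<nu> Q) = ennreal (enn2real (epow (1 / q) (D * emeasure \<nu> Q)))"
      using D H.emeasure_compact_finite[OF Q] by (simp add: ennreal_mult_less_top)
    also have "k * (ennreal C1 * gradient \<mu> S p f) * \<dots>
      = ennreal (enn2real (epow (1 / q) (D * emeasure \<nu> Q)) * C1) * k * gradient \<mu> S p f"
      using C1(1) by (simp add: ennreal_mult ac_simps)
    also have "\<dots> \<le> ennreal C * k * gradient \<mu> S p f"
      using False by (intro mult_right_mono ennreal_leI) (auto simp: C_def)
    finally show ?thesis .
  next
    case True
    define c where "c = ennreal C1 * gradient \<mu> S p f"
    note [measurable] = f G.baire_measurable[OF f] slice_measurable[OF f] displacement_joint_measurable[OF f]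
    define \<Psi> where "\<Psi> u x = indicator Q u * (indicator {y. y > c} (ennreal \<bar>f x - f (- u + x)\<bar>) :: ennreal)" for u x
    have \<Psi>: "case_prod \<Psi> \<in> borel_measurable (\<nu> \<Otimes>\<^sub>M baire)"
    proof -
      have "(\<lambda>z. indicator Q (fst z) * (indicator {y. y > c} (ennreal \<bar>(\<lambda>(u, x). f x - f (- u + x)) z\<bar>) :: ennreal))
         \<in> borel_measurable (\<nu> \<Otimes>\<^sub>M baire)"
        by measurable
      then show ?thesis
        by (simp add: \<Psi>_def split_beta')
    qed
    have "(\<integral>\<^sup>+ g. \<Psi> u g \<partial>\<mu>) = 0" for u
    proof (cases "u \<in> Q")
      case True
      have "esssup \<mu> (\<lambda>x. ennreal \<bar>f x - f (- u + x)\<bar>) \<le> c"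
        using C1(2)[of f u] True N \<open>p = \<infinity>\<close> by (auto simp: c_def Lp_norm_infinity left_translate_def)
      then have "AE x in \<mu>. ennreal \<bar>f x - f (- u + x)\<bar> \<le> c"
        using esssup_AE[of "\<lambda>x. ennreal \<bar>f x - f (- u + x)\<bar>" \<mu>]
        by (auto elim!: eventually_mono intro: order_trans)
      then have "AE x in \<mu>. \<Psi> u x = 0"
        by eventually_elim (simp add: \<Psi>_def indicator_def not_less)
      then have "(\<integral>\<^sup>+ g. \<Psi> u g \<partial>\<mu>) = (\<integral>\<^sup>+ g. 0 \<partial>\<mu>)"
        by (rule nn_integral_cong_AE)
      then show ?thesis by simp
    qed (simp add: \<Psi>_def)
    then have "(\<integral>\<^sup>+ g. \<phi> g * (\<integral>\<^sup>+ u. (\<integral>\<^sup>+ h. \<Psi> u (h + g) \<partial>\<nu>) \<partial>\<nu>) \<partial>\<mu>) = 0"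
      using disintegration_parametric(1)[OF \<phi> dis \<Psi>] by simp
    moreover have "(\<lambda>g. \<phi> g * (\<integral>\<^sup>+ u. (\<integral>\<^sup>+ h. \<Psi> u (h + g) \<partial>\<nu>) \<partial>\<nu>)) \<in> borel_measurable \<mu>"
      using disintegration_parametric(3)[OF \<phi> dis \<Psi>] by measurable
    ultimately have ae1: "AE g in \<mu>. \<phi> g * (\<integral>\<^sup>+ u. (\<integral>\<^sup>+ h. \<Psi> u (h + g) \<partial>\<nu>) \<partial>\<nu>) = 0"
      by (simp add: nn_integral_0_iff_AE)
    define tail where "tail M x = (indicator {y. y > M} (ennreal \<bar>f x\<bar>) :: ennreal)" for M x
    have tail [measurable]: "tail M \<in> borel_measurable baire" for M
      unfolding tail_def by measurable
    have sec_fin: "(\<integral>\<^sup>+ h. tail M (h + g) \<partial>\<nu>) = 0 \<longleftrightarrow> (AE h in \<nu>. ennreal \<bar>slice f g h\<bar> \<le> M)" for M g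
    proof -
      have "(\<lambda>h. tail M (h + g)) \<in> borel_measurable \<nu>"
        using slice_measurable[OF tail, of M g] by (simp add: slice_def)
      then show ?thesis
        by (simp add: nn_integral_0_iff_AE) (simp add: tail_def slice_def indicator_def not_less)
    qed
    have tail_meas: "(\<lambda>g. \<phi> g * (\<integral>\<^sup>+ h. tail M (h + g) \<partial>\<nu>)) \<in> borel_measurable \<mu>" for M
    proof -
      have "(\<lambda>(g, h). tail M (h + g)) \<in> borel_measurable (\<mu> \<Otimes>\<^sub>M \<nu>)"
        unfolding split_beta'
        by (intro measurable_compose[OF _ tail] G.measurable_add_baire
            measurable_compose[OF measurable_snd H.measurable_ident_haar]
            measurable_compose[OF measurable_fst G.ident_baire])
      then have [measurable]: "(\<lambda>g. \<integral>\<^sup>+ h. tail M (h + g) \<partial>\<nu>) \<in> borel_measurable \<mu>"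
        by (intro sigma_finite_measure.borel_measurable_nn_integral[OF H.sigma_finite])
      show ?thesis
        by measurable
    qed
    have "AE x in \<mu>. tail (Lp_norm \<mu> p f) x = 0"
      using esssup_AE[of "\<lambda>x. ennreal \<bar>f x\<bar>" \<mu>] True
      by (auto simp: tail_def Lp_norm_infinity indicator_def elim!: eventually_mono)
    then have "(\<integral>\<^sup>+ x. tail (Lp_norm \<mu> p f) x \<partial>\<mu>) = 0"
      by (simp add: nn_integral_0_iff_AE G.baire_measurable[OF tail])
    then have "(\<integral>\<^sup>+ g. \<phi> g * (\<integral>\<^sup>+ h. tail (Lp_norm \<mu> p f) (h + g) \<partial>\<nu>) \<partial>\<mu>) = 0"
      by (simp add: dis[OF tail])
    then have ae2: "AE g in \<mu>. \<phi> g * (\<integral>\<^sup>+ h. tail (Lp_norm \<mu> p f) (h + g) \<partial>\<nu>) = 0"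
      using tail_meas by (simp add: nn_integral_0_iff_AE)
    define B where "B = k * (8 * c)"
    have "AE g in \<mu>. \<phi> g * (\<integral>\<^sup>+ h. tail B (h + g) \<partial>\<nu>) = 0"
      using ae1 ae2
    proof eventually_elim
      case (elim g)
      show ?case
      proof (cases "\<phi> g = 0")
        case False
        then have 1: "(\<integral>\<^sup>+ u. (\<integral>\<^sup>+ h. \<Psi> u (h + g) \<partial>\<nu>) \<partial>\<nu>) = 0"
          and 2: "AE h in \<nu>. ennreal \<bar>slice f g h\<bar> \<le> Lp_norm \<mu> p f"
          using elim by (auto simp: sec_fin)
        have "Lp_norm \<nu> p (slice f g) \<le> Lp_norm \<mu> p f"
          unfolding True infinity_ennreal_def Lp_norm_infinity[of \<nu>]
          using 2 True by (intro esssup_I) auto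
        then have "Lp_norm \<nu> p (slice f g) \<le> k * gradient \<nu> T p (slice f g)"
          using fin by (intro hyp) (rule le_less_trans)
        also have "\<dots> \<le> B"
          unfolding B_def gradient_def
        proof (intro mult_left_mono SUP_least)
          fix t assume t: "t \<in> T"
          have "AE u in \<nu>. (\<integral>\<^sup>+ h. \<Psi> u (h + g) \<partial>\<nu>) = 0"
            using 1 disintegration_parametric(2)[OF \<phi> dis \<Psi>] by (simp add: nn_integral_0_iff_AE)
          then have "AE u in \<nu>. u \<in> Q \<longrightarrow> Lp_norm \<nu> \<infinity> (\<lambda>y. slice f g y - left_translate u (slice f g) y) \<le> c"
          proof (rule AE_mp, intro AE_I2 impI)
            fix u assume uH: "u \<in> space \<nu>" and 0: "(\<integral>\<^sup>+ h. \<Psi> u (h + g) \<partial>\<nu>) = 0" and u: "u \<in> Q"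
            have d: "(\<lambda>y. slice f g y - left_translate u (slice f g) y) \<in> borel_measurable \<nu>"
              using uH by (intro H.displacement_measurable) auto
            have "(\<lambda>x. (u, x)) \<in> baire \<rightarrow>\<^sub>M \<nu> \<Otimes>\<^sub>M baire"
              using uH by (rule measurable_Pair1')
            from slice_measurable[OF measurable_compose[OF this \<Psi>], of g]
            have "(\<lambda>h. \<Psi> u (h + g)) \<in> borel_measurable \<nu>"
              by (simp add: slice_def)
            then have "AE h in \<nu>. \<Psi> u (h + g) = 0"
              using 0 by (simp add: nn_integral_0_iff_AE)
            then have "AE h in \<nu>. ennreal \<bar>slice f g h - left_translate u (slice f g) h\<bar> \<le> c"
              by eventually_elim
                 (use u in \<open>auto simp: \<Psi>_def indicator_def slice_def left_translate_def add.assoc not_less split: if_splits\<close>)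
            then show "Lp_norm \<nu> \<infinity> (\<lambda>y. slice f g y - left_translate u (slice f g) y) \<le> c"
              unfolding infinity_ennreal_def Lp_norm_infinity using d by (intro esssup_I) auto
          qed
          then show "Lp_norm \<nu> p (\<lambda>y. slice f g y - left_translate t (slice f g) y) \<le> 8 * c"
            unfolding True by (intro avg'[OF _ t]) auto
        qed auto
        finally have "AE h in \<nu>. ennreal \<bar>slice f g h\<bar> \<le> B"
          using esssup_AE[of "\<lambda>h. ennreal \<bar>slice f g h\<bar>" \<nu>] True
          by (auto simp: Lp_norm_infinity elim!: eventually_mono)
        then show ?thesis
          by (simp add: sec_fin)
      qed simp
    qed
    then have "(\<integral>\<^sup>+ x. tail B x \<partial>\<mu>) = 0"
      unfolding dis[OF tail, symmetric] using tail_meas by (simp add: nn_integral_0_iff_AE)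
    then have "AE x in \<mu>. ennreal \<bar>f x\<bar> \<le> B"
      by (simp add: nn_integral_0_iff_AE G.baire_measurable[OF tail])
         (simp add: tail_def indicator_def not_less)
    then have "Lp_norm \<mu> p f \<le> B"
      unfolding True infinity_ennreal_def Lp_norm_infinity by (intro esssup_I) auto
    also have "B = ennreal C * k * gradient \<mu> S p f"
      using True C1(1) by (simp add: B_def c_def C_def ennreal_mult ac_simps)
    finally show ?thesis .
  qed
  ultimately show ?thesis
    by blast
qed

end

section \<open>Gradients and the isoperimetric constants of sets\<close>

lemma ennreal_divide_leI:
  fixes a b k :: ennreal
  assumes "a \<le> k * b" shows "a / b \<le> k"
proof (cases "b = 0")
  case False
  then show ?thesis
    using assms by (intro divide_le_posI_ennreal) (auto simp: mult.commute zero_less_iff_neq_zero)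
qed (use assms in simp)

lemma isop_J_leI:
  assumes "\<And>f. f \<in> borel_measurable M \<Longrightarrow> Lp_norm M p f < \<infinity> \<Longrightarrow> AE x in M. x \<notin> A \<longrightarrow> f x = 0 \<Longrightarrow>
    Lp_norm M p f \<le> k * gradient M S p f"
  shows "isop_J M S p A \<le> k"
  unfolding isop_J_def gradient_def[symmetric]
  by (rule SUP_least) (auto intro!: ennreal_divide_leI assms)

context haar_subgroup
begin

lemma gradient_le:
  assumes f: "f \<in> borel_measurable \<nu>" and p: "1 \<le> p"
  shows "gradient \<nu> T p f \<le> 8 * Lp_norm \<nu> p f"
  unfolding gradient_def
proof (rule SUP_least)
  fix s assume "s \<in> T"
  then have s: "s \<in> K"
    using T_subset by auto
  have "Lp_norm \<nu> p (\<lambda>x. f x - left_translate s f x) \<le> 4 * (Lp_norm \<nu> p f + Lp_norm \<nu> p (left_translate s f))"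
    by (intro Lp_norm_diff_le f p left_translate_measurable s)
  then show "Lp_norm \<nu> p (\<lambda>x. f x - left_translate s f x) \<le> 8 * Lp_norm \<nu> p f"
    by (simp add: Lp_norm_left_translate[OF f s] mult_2[symmetric] mult.assoc[symmetric])
qed

lemma gradient_add_le:
  assumes f: "f \<in> borel_measurable \<nu>" and g: "g \<in> borel_measurable \<nu>" and p: "1 \<le> p"
  shows "gradient \<nu> T p (\<lambda>x. f x - g x) \<le> 4 * (gradient \<nu> T p f + gradient \<nu> T p g)"
  unfolding gradient_def
proof (rule SUP_least)
  fix s assume sT: "s \<in> T"
  then have s: "s \<in> K"
    using T_subset by auto
  have "(\<lambda>x. (f x - g x) - left_translate s (\<lambda>x. f x - g x) x)
    = (\<lambda>x. (f x - left_translate s f x) - (g x - left_translate s g x))"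
    by (auto simp: left_translate_def)
  then have "Lp_norm \<nu> p (\<lambda>x. (f x - g x) - left_translate s (\<lambda>x. f x - g x) x)
    \<le> 4 * (Lp_norm \<nu> p (\<lambda>x. f x - left_translate s f x) + Lp_norm \<nu> p (\<lambda>x. g x - left_translate s g x))"
    using Lp_norm_diff_le[OF displacement_measurable[OF f s] displacement_measurable[OF g s] p] by simp
  also have "\<dots> \<le> 4 * ((SUP s\<in>T. Lp_norm \<nu> p (\<lambda>x. f x - left_translate s f x))
      + (SUP s\<in>T. Lp_norm \<nu> p (\<lambda>x. g x - left_translate s g x)))"
    by (intro mult_left_mono add_mono SUP_upper sT) auto
  finally show "Lp_norm \<nu> p (\<lambda>x. (f x - g x) - left_translate s (\<lambda>x. f x - g x) x)
    \<le> 4 * ((SUP s\<in>T. Lp_norm \<nu> p (\<lambda>x. f x - left_translate s f x))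
      + (SUP s\<in>T. Lp_norm \<nu> p (\<lambda>x. g x - left_translate s g x)))" .
qed

lemma gradient_cong_AE:
  assumes f: "f \<in> borel_measurable \<nu>" and g: "g \<in> borel_measurable \<nu>" and p: "1 \<le> p"
    and ae: "AE x in \<nu>. f x = g x"
  shows "gradient \<nu> T p f = gradient \<nu> T p g"
  unfolding gradient_def
proof (intro SUP_cong refl)
  fix s assume "s \<in> T"
  then have s: "s \<in> K"
    using T_subset by auto
  have "AE x in \<nu>. f (- s + x) = g (- s + x)"
    by (rule AE_left_translation[OF _ ae]) (use s in simp)
  with ae have "AE x in \<nu>. f x - left_translate s f x = g x - left_translate s g x"
    by eventually_elim (simp add: left_translate_def)
  then show "Lp_norm \<nu> p (\<lambda>x. f x - left_translate s f x) = Lp_norm \<nu> p (\<lambda>x. g x - left_translate s g x)"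
    by (intro Lp_norm_cong_AE displacement_measurable f g s p)
qed

text \<open>Finiteness of \<open>k\<close> matters: if the gradient vanishes and \<open>k = \<infinity>\<close>, the right-hand side is \<open>0\<close>.\<close>

lemma Lp_norm_le_isop_J:
  assumes f: "f \<in> borel_measurable \<nu>" and p: "1 \<le> p" and fin: "Lp_norm \<nu> p f < \<infinity>"
    and supp: "AE x in \<nu>. x \<notin> A \<longrightarrow> f x = 0" and J: "isop_J \<nu> T p A \<le> k" and k: "k < \<infinity>"
  shows "Lp_norm \<nu> p f \<le> k * gradient \<nu> T p f"
proof (cases "AE x in \<nu>. f x = 0")
  case True
  then have "Lp_norm \<nu> p f = Lp_norm \<nu> p (\<lambda>x. 0)"
    by (intro Lp_norm_cong_AE f p) auto
  then show ?thesis
    by (simp add: Lp_norm_zero[OF p])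
next
  case False
  have "Lp_norm \<nu> p f / gradient \<nu> T p f \<le> isop_J \<nu> T p A"
    unfolding isop_J_def gradient_def[symmetric] using f fin supp False by (intro SUP_upper) auto
  with J have le: "Lp_norm \<nu> p f / gradient \<nu> T p f \<le> k"
    by (rule order_trans[rotated])
  have "Lp_norm \<nu> p f \<noteq> 0"
    using Lp_norm_eq_0[OF f p] False by blast
  then have g0: "gradient \<nu> T p f \<noteq> 0"
    using le k by (auto simp: top_unique)
  have "8 * Lp_norm \<nu> p f < top"
    using fin by (simp add: ennreal_mult_less_top)
  with gradient_le[OF f p] have "gradient \<nu> T p f < top"
    by (rule le_less_trans)
  then have "Lp_norm \<nu> p f = (Lp_norm \<nu> p f / gradient \<nu> T p f) * gradient \<nu> T p f"
    using g0 by (simp add: ennreal_divide_times)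
  also have "\<dots> \<le> k * gradient \<nu> T p f"
    by (intro mult_right_mono le) simp
  finally show ?thesis .
qed

text \<open>The indicator of a ball has a gradient of at most \<open>8\<close> times its norm. With this bound, terms
  controlled by the gradient alone are absorbed into the profile.\<close>

lemma isop_profile_lower_bound:
  assumes p: "1 \<le> p"
  obtains v0 where "\<And>v. v \<ge> v0 \<Longrightarrow> 1 \<le> 8 * isop_profile \<nu> T p v"
proof -
  obtain n where n: "emeasure \<nu> (set_power T n) > 0" "emeasure \<nu> (set_power T n) < \<infinity>"
    "set_power T n \<in> sets \<nu>"
    by (rule ball_positive_measure)
  define V where "V = set_power T n"
  note V [measurable] = n[folded V_def]
  let ?f = "indicator V :: 'a \<Rightarrow> real"
  have f: "?f \<in> borel_measurable \<nu>"
    by measurable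
  have fin: "Lp_norm \<nu> p ?f < \<infinity>"
  proof (cases "p = \<infinity>")
    case True
    have "esssup \<nu> (\<lambda>x. ennreal \<bar>?f x\<bar>) \<le> 1"
      by (rule esssup_I) (auto simp: indicator_def)
    also have "\<dots> < \<infinity>" by simp
    finally show ?thesis
      using True by (simp add: Lp_norm_infinity)
  next
    case False
    have "pow_integral \<nu> (enn2real p) ?f = (\<integral>\<^sup>+ x. indicator V x \<partial>\<nu>)"
      unfolding pow_integral_def by (intro nn_integral_cong) (auto simp: indicator_def)
    also have "\<dots> < \<infinity>"
      using V by simp
    finally show ?thesis
      using False by (simp add: Lp_norm_finite)
  qed
  have nz: "\<not> (AE x in \<nu>. ?f x = 0)"
  proof
    assume "AE x in \<nu>. ?f x = 0"
    then have "AE x in \<nu>. x \<notin> V"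
      by eventually_elim (auto simp: indicator_def split: if_splits)
    then show False
      using AE_iff_null_sets[OF V(3)] V(1) by auto
  qed
  show ?thesis
  proof
    fix v assume v: "v \<ge> enn2real (emeasure \<nu> V)"
    have "isop_J \<nu> T p V \<le> isop_profile \<nu> T p v"
      unfolding isop_profile_def
    proof (rule SUP_upper)
      have "emeasure \<nu> V = ennreal (enn2real (emeasure \<nu> V))"
        using V(2) by simp
      also have "\<dots> \<le> ennreal v"
        using v by (rule ennreal_leI)
      finally show "V \<in> {A \<in> sets \<nu>. emeasure \<nu> A \<le> ennreal v}"
        using V(3) by simp
    qed
    show "1 \<le> 8 * isop_profile \<nu> T p v"
    proof (cases "isop_profile \<nu> T p v < \<infinity>")
      case True
      have "Lp_norm \<nu> p ?f \<le> isop_profile \<nu> T p v * gradient \<nu> T p ?f"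
        using \<open>isop_J \<nu> T p V \<le> _\<close> True by (intro Lp_norm_le_isop_J[OF f p fin, of V]) auto
      also have "\<dots> \<le> isop_profile \<nu> T p v * (8 * Lp_norm \<nu> p ?f)"
        by (intro mult_left_mono gradient_le f p) simp
      finally have "Lp_norm \<nu> p ?f * 1 \<le> Lp_norm \<nu> p ?f * (8 * isop_profile \<nu> T p v)"
        by (simp add: ac_simps)
      moreover have "Lp_norm \<nu> p ?f \<noteq> 0" "Lp_norm \<nu> p ?f \<noteq> top"
        using Lp_norm_eq_0[OF f p] nz fin by auto
      ultimately show ?thesis
        by (subst (asm) ennreal_mult_le_mult_iff)
    qed (simp add: less_top[symmetric])
  qed
qed

end

section \<open>The thin part of the support\<close>

context haar_group
begin

text \<open>How much of \<open>U + x\<close> lies in \<open>E\<close>. In a unimodular group this is the measure of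
  \<open>E \<inter> (U + x)\<close>; the integral over \<open>U\<close> makes the measurability in \<open>x\<close> apparent.\<close>

definition occupancy :: "'a set \<Rightarrow> 'a set \<Rightarrow> 'a \<Rightarrow> ennreal" where
  "occupancy U E x = (\<integral>\<^sup>+ u. indicator U u * indicator E (u + x) \<partial>\<mu>)"

lemma measurable_fst_borel: "fst \<in> \<mu> \<Otimes>\<^sub>M N \<rightarrow>\<^sub>M borel"
  by (rule measurable_compose[OF measurable_fst measurable_ident_haar])

lemma indicator_action_measurable:
  assumes "E \<in> sets baire"
  shows "(\<lambda>z. indicator E (fst z + snd z) :: ennreal) \<in> borel_measurable (\<mu> \<Otimes>\<^sub>M baire)"
proof -
  have "(\<lambda>z. fst z + snd z) \<in> \<mu> \<Otimes>\<^sub>M baire \<rightarrow>\<^sub>M baire"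
    by (intro measurable_add_baire measurable_fst_borel measurable_snd)
  from measurable_compose[OF this borel_measurable_indicator[OF assms]] show ?thesis .
qed

lemma indicator_section_measurable:
  assumes E: "E \<in> sets baire"
  shows "(\<lambda>u. indicator E (u + x) :: ennreal) \<in> borel_measurable \<mu>"
proof -
  have "(\<lambda>u. u + x) \<in> \<mu> \<rightarrow>\<^sub>M baire"
    by (intro measurable_add_baire measurable_ident_haar) simp
  from measurable_compose[OF this borel_measurable_indicator[OF E]] show ?thesis .
qed

lemma occupancy_measurable:
  assumes U: "U \<in> sets \<mu>" and E: "E \<in> sets baire"
  shows "occupancy U E \<in> borel_measurable baire"
  unfolding occupancy_def
proof (rule sigma_finite_measure.borel_measurable_nn_integral[OF sigma_finite])
  note [measurable] = U indicator_action_measurable[OF E]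
  have "(\<lambda>z. indicator U (fst z) * indicator E (fst z + snd z) :: ennreal) \<in> borel_measurable (\<mu> \<Otimes>\<^sub>M baire)"
    by measurable
  from measurable_compose[OF measurable_pair_swap' this]
  show "(\<lambda>(x, u). indicator U u * indicator E (u + x) :: ennreal) \<in> borel_measurable (baire \<Otimes>\<^sub>M \<mu>)"
    by (simp add: split_beta')
qed

text \<open>At a point \<open>x\<close> where \<open>E\<close> fills at most half of \<open>U + x\<close>, at least half of the \<open>u \<in> U\<close> move
  \<open>x\<close> out of \<open>E\<close>.\<close>

lemma thin_mass_le:
  assumes U: "U \<in> sets \<mu>" "emeasure \<mu> U < \<infinity>" and E: "E \<in> sets baire"
    and w: "w \<in> borel_measurable baire" and thin: "\<And>x. w x \<noteq> 0 \<Longrightarrow> 2 * occupancy U E x \<le> emeasure \<mu> U"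
  shows "emeasure \<mu> U * (\<integral>\<^sup>+ x. w x \<partial>\<mu>) \<le>
    2 * (\<integral>\<^sup>+ u. indicator U u * (\<integral>\<^sup>+ x. w x * indicator (- E) (u + x) \<partial>\<mu>) \<partial>\<mu>)"
proof -
  interpret pair_sigma_finite \<mu> \<mu>
    by (intro pair_sigma_finite.intro sigma_finite)
  have E': "- E \<in> sets baire"
    using E sets.compl_sets[OF E] by (simp add: Compl_eq_Diff_UNIV)
  note [measurable] = U(1) baire_measurable[OF w] indicator_section_measurable[OF E]
    indicator_section_measurable[OF E'] baire_measurable[OF occupancy_measurable[OF U(1) E']]
  have half: "w x * emeasure \<mu> U \<le> 2 * (w x * occupancy U (- E) x)" for x
  proof (cases "w x = 0")
    case False
    have "emeasure \<mu> U = (\<integral>\<^sup>+ u. indicator U u * indicator E (u + x) + indicator U u * indicator (- E) (u + x) \<partial>\<mu>)"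
      by (subst nn_integral_indicator[symmetric, OF U(1)], intro nn_integral_cong) (auto simp: indicator_def)
    also have "\<dots> = occupancy U E x + occupancy U (- E) x"
      unfolding occupancy_def by (intro nn_integral_add) measurable
    finally have sum: "emeasure \<mu> U = occupancy U E x + occupancy U (- E) x" .
    obtain a b where ab: "occupancy U E x = ennreal a" "a \<ge> 0" "occupancy U (- E) x = ennreal b" "b \<ge> 0"
      using sum U(2) by (cases "occupancy U E x"; cases "occupancy U (- E) x") auto
    have "emeasure \<mu> U \<le> 2 * occupancy U (- E) x"
      using thin[OF False] ab unfolding sum
      by (simp add: ennreal_mult[symmetric] ennreal_plus[symmetric] ennreal_numeral[symmetric]
          del: ennreal_plus ennreal_numeral)
    then show ?thesis
      using mult_left_mono[of _ _ "w x"] by (simp add: mult.left_commute)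
  qed simp
  have "emeasure \<mu> U * (\<integral>\<^sup>+ x. w x \<partial>\<mu>) = (\<integral>\<^sup>+ x. w x * emeasure \<mu> U \<partial>\<mu>)"
    by (simp add: nn_integral_multc mult.commute)
  also have "\<dots> \<le> (\<integral>\<^sup>+ x. 2 * (w x * occupancy U (- E) x) \<partial>\<mu>)"
    by (intro nn_integral_mono half)
  also have "\<dots> = 2 * (\<integral>\<^sup>+ x. w x * occupancy U (- E) x \<partial>\<mu>)"
    by (rule nn_integral_cmult) measurable
  also have "(\<integral>\<^sup>+ x. w x * occupancy U (- E) x \<partial>\<mu>)
    = (\<integral>\<^sup>+ x. (\<integral>\<^sup>+ u. w x * (indicator U u * indicator (- E) (u + x)) \<partial>\<mu>) \<partial>\<mu>)"
    unfolding occupancy_def by (intro nn_integral_cong nn_integral_cmult[symmetric]) measurable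
  also have "\<dots> = (\<integral>\<^sup>+ u. (\<integral>\<^sup>+ x. w x * (indicator U u * indicator (- E) (u + x)) \<partial>\<mu>) \<partial>\<mu>)"
  proof (rule Fubini'[symmetric])
    have "(\<lambda>z. (fst z, snd z)) \<in> \<mu> \<Otimes>\<^sub>M \<mu> \<rightarrow>\<^sub>M \<mu> \<Otimes>\<^sub>M baire"
      by (intro measurable_Pair measurable_fst measurable_compose[OF measurable_snd ident_baire])
    from measurable_compose[OF this indicator_action_measurable[OF E']]
    have [measurable]: "(\<lambda>z. indicator (- E) (fst z + snd z) :: ennreal) \<in> borel_measurable (\<mu> \<Otimes>\<^sub>M \<mu>)"
      by simp
    have "(\<lambda>z. w (fst z) * (indicator U (snd z) * indicator (- E) (snd z + fst z)))
      \<in> borel_measurable (\<mu> \<Otimes>\<^sub>M \<mu>)"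
      using measurable_compose[OF measurable_pair_swap'
          \<open>(\<lambda>z. indicator (- E) (fst z + snd z) :: ennreal) \<in> borel_measurable (\<mu> \<Otimes>\<^sub>M \<mu>)\<close>]
      by (intro borel_measurable_times_ennreal) (auto simp: split_beta')
    then show "(\<lambda>(x, u). w x * (indicator U u * indicator (- E) (u + x))) \<in> borel_measurable (\<mu> \<Otimes>\<^sub>M \<mu>)"
      by (simp add: split_beta')
  qed
  also have "\<dots> = (\<integral>\<^sup>+ u. indicator U u * (\<integral>\<^sup>+ x. w x * indicator (- E) (u + x) \<partial>\<mu>) \<partial>\<mu>)"
    by (intro nn_integral_cong) (auto simp: indicator_def)
  finally show ?thesis .
qed

end

context haar_group
begin

text \<open>A displacement that moves \<open>x\<close> out of the support changes \<open>f\<close> at \<open>x\<close> by \<open>f x\<close> itself. By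
  \<open>thin_mass_le\<close> this happens for a fixed proportion of the pairs \<open>(u, x)\<close> with \<open>x\<close> in the thin
  part, weighted by a power of \<open>f\<close> or, for \<open>p = \<infinity>\<close>, by the indicator of the set where
  \<open>f\<close> exceeds its displacements.\<close>

lemma thin_part_le_gradient:
  assumes p: "1 \<le> p" and U: "U = set_power S n" "emeasure \<mu> U > 0"
  shows "\<exists>C::real. C > 0 \<and> (\<forall>f. f \<in> borel_measurable baire \<longrightarrow>
    Lp_norm \<mu> p (\<lambda>x. if 2 * occupancy U {x. f x \<noteq> 0} x \<le> emeasure \<mu> U then f x else 0)
      \<le> ennreal C * gradient \<mu> S p f)"
proof -
  have Us [measurable]: "U \<in> sets \<mu>" and fin: "emeasure \<mu> U < \<infinity>"
    using compact_in_sets emeasure_compact_finite compact_set_power_T by (auto simp: U)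
  obtain C1 where C1: "C1 > 0" "\<And>f x. f \<in> borel_measurable \<mu> \<Longrightarrow> x \<in> (\<Union>m\<le>n. set_power S m) \<Longrightarrow>
      Lp_norm \<mu> p (\<lambda>y. f y - left_translate x f y) \<le> ennreal C1 * gradient \<mu> S p f"
    using displacement_le_gradient[OF p, of n] by blast
  have "Lp_norm \<mu> p (\<lambda>x. if 2 * occupancy U {x. f x \<noteq> 0} x \<le> emeasure \<mu> U then f x else 0)
      \<le> ennreal (2 * C1) * gradient \<mu> S p f" if f: "f \<in> borel_measurable baire" for f
  proof -
    define E where "E = {x. f x \<noteq> 0}"
    define B where "B = {x. 2 * occupancy U E x \<le> emeasure \<mu> U}"
    define c where "c = ennreal C1 * gradient \<mu> S p f"
    note [measurable] = f baire_measurable[OF f]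
    have E: "E \<in> sets baire"
      unfolding E_def using measurable_sets[OF f, of "- {0}"] by (simp add: vimage_def)
    note [measurable] = occupancy_measurable[OF Us E]
    have B [measurable]: "B \<in> sets baire"
    proof -
      have "{x \<in> space baire. 2 * occupancy U E x \<le> emeasure \<mu> U} \<in> sets baire"
        by measurable
      then show ?thesis
        by (simp add: B_def)
    qed
    have B\<mu> [measurable]: "B \<in> sets \<mu>"
      using sets_baire_subset[OF B] by (simp add: sets_borel)
    have disp: "Lp_norm \<mu> p (\<lambda>x. f x - f (u + x)) \<le> c" if "u \<in> U" for u
      using C1(2)[of f "- u"] set_power_uminus[OF uminus_S, of u n] that
      by (auto simp: c_def U left_translate_def)
    have tr [measurable]: "(\<lambda>x. f (u + x)) \<in> borel_measurable \<mu>" for u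
      using left_translate_measurable[of f "- u"] by (simp add: left_translate_def)
    have mass: "emeasure \<mu> U * (\<integral>\<^sup>+ x. w x \<partial>\<mu>) \<le>
      2 * (\<integral>\<^sup>+ u. indicator U u * (\<integral>\<^sup>+ x. w x * indicator (- E) (u + x) \<partial>\<mu>) \<partial>\<mu>)"
      if "w \<in> borel_measurable baire" "\<And>x. w x \<noteq> 0 \<Longrightarrow> x \<in> B" for w :: "'a \<Rightarrow> ennreal"
      by (rule thin_mass_le[OF Us fin E]) (use that in \<open>auto simp: B_def\<close>)
    have "Lp_norm \<mu> p (\<lambda>x. if x \<in> B then f x else 0) \<le> 2 * c"
    proof (cases "p = \<infinity>")
      case False
      define q where "q = enn2real p"
      have q: "q \<ge> 1"
        using p False unfolding q_def by (cases p) auto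
      have Lp: "Lp_norm \<mu> p F = epow (1 / q) (pow_integral \<mu> q F)" for F
        using False by (simp add: Lp_norm_finite q_def)
      define w where "w x = ennreal (\<bar>f x\<bar> powr q) * indicator B x" for x
      have w: "w \<in> borel_measurable baire"
        unfolding w_def by measurable
      have "emeasure \<mu> U * (\<integral>\<^sup>+ x. w x \<partial>\<mu>) \<le>
        2 * (\<integral>\<^sup>+ u. indicator U u * (\<integral>\<^sup>+ x. w x * indicator (- E) (u + x) \<partial>\<mu>) \<partial>\<mu>)"
        by (rule mass[OF w]) (auto simp: w_def indicator_def split: if_splits)
      also have "\<dots> \<le> 2 * (\<integral>\<^sup>+ u. epow q c * indicator U u \<partial>\<mu>)"
      proof (intro mult_left_mono nn_integral_mono)
        fix u
        show "indicator U u * (\<integral>\<^sup>+ x. w x * indicator (- E) (u + x) \<partial>\<mu>) \<le> epow q c * indicator U u"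
        proof (cases "u \<in> U")
          case True
          have "(\<integral>\<^sup>+ x. w x * indicator (- E) (u + x) \<partial>\<mu>) \<le> pow_integral \<mu> q (\<lambda>x. f x - f (u + x))"
            unfolding pow_integral_def by (intro nn_integral_mono) (auto simp: w_def E_def indicator_def)
          also have "\<dots> = epow q (Lp_norm \<mu> p (\<lambda>x. f x - f (u + x)))"
            using q by (simp add: Lp epow_epow)
          also have "\<dots> \<le> epow q c"
            using q disp[OF True] by (intro epow_mono) auto
          finally show ?thesis
            using True by simp
        qed simp
      qed simp
      also have "\<dots> = emeasure \<mu> U * (2 * epow q c)"
        by (subst nn_integral_cmult_indicator) (auto simp: ac_simps)
      finally have "(\<integral>\<^sup>+ x. w x \<partial>\<mu>) \<le> 2 * epow q c"
        using U(2) fin by (subst (asm) ennreal_mult_le_mult_iff) auto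
      moreover have "pow_integral \<mu> q (\<lambda>x. if x \<in> B then f x else 0) = (\<integral>\<^sup>+ x. w x \<partial>\<mu>)"
        unfolding pow_integral_def w_def by (intro nn_integral_cong) auto
      ultimately have "Lp_norm \<mu> p (\<lambda>x. if x \<in> B then f x else 0) \<le> epow (1 / q) (2 * epow q c)"
        unfolding Lp using q by (intro epow_mono) auto
      also have "\<dots> = ennreal (2 powr (1 / q)) * c"
        using q epow_ennreal[of 2 "1 / q"] by (simp add: epow_mult epow_epow)
      also have "\<dots> \<le> ennreal 2 * c"
        using q powr_mono[of "1 / q" 1 2] by (intro mult_right_mono ennreal_leI) auto
      finally show ?thesis by simp
    next
      case True
      define w where "w x = (indicator B x * indicator {y. y > c} (ennreal \<bar>f x\<bar>) :: ennreal)" for x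
      have w: "w \<in> borel_measurable baire"
        unfolding w_def by measurable
      have "emeasure \<mu> U * (\<integral>\<^sup>+ x. w x \<partial>\<mu>) \<le>
        2 * (\<integral>\<^sup>+ u. indicator U u * (\<integral>\<^sup>+ x. w x * indicator (- E) (u + x) \<partial>\<mu>) \<partial>\<mu>)"
        by (rule mass[OF w]) (auto simp: w_def indicator_def split: if_splits)
      also have "(\<integral>\<^sup>+ u. indicator U u * (\<integral>\<^sup>+ x. w x * indicator (- E) (u + x) \<partial>\<mu>) \<partial>\<mu>) = (\<integral>\<^sup>+ u. 0 \<partial>\<mu>)"
      proof (intro nn_integral_cong)
        fix u
        show "indicator U u * (\<integral>\<^sup>+ x. w x * indicator (- E) (u + x) \<partial>\<mu>) = 0"
        proof (cases "u \<in> U")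
          case u: True
          have "AE x in \<mu>. ennreal \<bar>f x - f (u + x)\<bar> \<le> c"
            using esssup_AE[of "\<lambda>x. ennreal \<bar>f x - f (u + x)\<bar>" \<mu>] disp[OF u] True
            by (auto simp: Lp_norm_infinity elim!: eventually_mono intro: order_trans)
          then have "AE x in \<mu>. w x * indicator (- E) (u + x) = 0"
            by eventually_elim (auto simp: w_def E_def indicator_def not_less)
          then have "(\<integral>\<^sup>+ x. w x * indicator (- E) (u + x) \<partial>\<mu>) = (\<integral>\<^sup>+ x. 0 \<partial>\<mu>)"
            by (rule nn_integral_cong_AE)
          then show ?thesis by simp
        qed simp
      qed
      finally have "(\<integral>\<^sup>+ x. w x \<partial>\<mu>) = 0"
        using U(2) by auto
      then have "AE x in \<mu>. w x = 0"
        using baire_measurable[OF w] by (simp add: nn_integral_0_iff_AE)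
      then have "AE x in \<mu>. ennreal \<bar>if x \<in> B then f x else 0\<bar> \<le> c"
        by eventually_elim (auto simp: w_def indicator_def not_less split: if_splits)
      then have "Lp_norm \<mu> p (\<lambda>x. if x \<in> B then f x else 0) \<le> c"
        unfolding True infinity_ennreal_def Lp_norm_infinity by (intro esssup_I) auto
      also have "\<dots> \<le> 2 * c"
        using mult_right_mono[of 1 "2 :: ennreal" c] by simp
      finally show ?thesis .
    qed
    then show ?thesis
      using C1(1) by (simp add: B_def E_def c_def ennreal_mult mult.assoc)
  qed
  then show ?thesis
    using C1(1) by (intro exI[of _ "2 * C1"]) auto
qed

end

context unimodular_pair
begin

section \<open>Packing the thick part of a coset\<close>

lemma occupancy_eq:
  assumes U: "U \<in> sets \<mu>" and E: "E \<in> sets \<mu>"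
  shows "G.occupancy U E k = emeasure \<mu> (E \<inter> (\<lambda>u. u + k) ` U)"
    and "E \<inter> (\<lambda>u. u + k) ` U \<in> sets \<mu>"
proof -
  let ?V = "U \<inter> (\<lambda>u. u + k) -` E"
  have "(\<lambda>u. u + k) -` E \<inter> space \<mu> \<in> sets \<mu>"
    using measurable_sets[OF G.measurable_right_translation'[of k] E] by simp
  then have V: "?V \<in> sets \<mu>"
    using U by auto
  have img: "E \<inter> (\<lambda>u. u + k) ` U = (\<lambda>u. u + k) ` ?V"
    by auto
  have "(\<lambda>u. u + k) ` ?V = (\<lambda>u. u + - k) -` ?V \<inter> space \<mu>"
    using vimage_add_right[of "- k" ?V] by simp
  also have "\<dots> \<in> sets \<mu>"
    by (rule measurable_sets[OF G.measurable_right_translation' V]) simp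
  finally show "E \<inter> (\<lambda>u. u + k) ` U \<in> sets \<mu>"
    unfolding img .
  have "G.occupancy U E k = (\<integral>\<^sup>+ u. indicator ?V u \<partial>\<mu>)"
    unfolding G.occupancy_def by (intro nn_integral_cong) (auto simp: indicator_def)
  also have "\<dots> = emeasure \<mu> ?V"
    using V by simp
  also have "\<dots> = emeasure \<mu> ((\<lambda>u. u + k) ` ?V)"
    by (rule G.emeasure_right_translation[OF _ V, symmetric]) simp
  finally show "G.occupancy U E k = emeasure \<mu> (E \<inter> (\<lambda>u. u + k) ` U)"
    unfolding img .
qed

text \<open>Points of \<open>H\<close> that are separated relative to \<open>U\<close> give disjoint right translates of \<open>U\<close>, all
  of the same measure since \<open>G\<close> is unimodular; if each is half filled by \<open>E\<close>, there are few of them.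
  A maximal separated family covers the thick part of the coset by translates of a fixed compact
  subset of \<open>H\<close>, of the same measure since \<open>H\<close> is unimodular.\<close>

lemma thick_slice_measure_le:
  assumes U: "compact U" "U \<noteq> {}" "emeasure \<mu> U > 0"
  shows "\<exists>C::real. C > 0 \<and> (\<forall>E v g. E \<in> sets \<mu> \<longrightarrow> v \<ge> 0 \<longrightarrow> emeasure \<mu> E \<le> ennreal v \<longrightarrow>
    emeasure \<nu> {h \<in> H. emeasure \<mu> U < 2 * G.occupancy U E (h + g)} \<le> ennreal (C * v))"
proof -
  have Us: "U \<in> sets \<mu>" and Ufin: "emeasure \<mu> U < \<infinity>"
    using G.compact_in_sets G.emeasure_compact_finite U(1) by auto
  define m where "m = enn2real (emeasure \<mu> U)"
  have m: "emeasure \<mu> U = ennreal m" "m > 0"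
    using Ufin U(3) by (auto simp: m_def enn2real_positive_iff)
  define D where "D = {a + b | a b. a \<in> uminus ` U \<and> b \<in> U}"
  define P where "P = H \<inter> D"
  have "compact (uminus ` U)"
    by (intro compact_continuous_image U continuous_intros)
  then have P: "compact P" "P \<subseteq> H"
    unfolding P_def D_def using H.closed U(1) by (auto intro!: closed_Int_compact compact_set_sum)
  have D_uminus: "- d \<in> D" if d: "d \<in> D" for d
  proof -
    obtain u u' where "u \<in> U" "u' \<in> U" "d = - u + u'"
      using d unfolding D_def by blast
    then have "- d = - u' + u"
      by (simp add: minus_add)
    then show ?thesis
      using \<open>u \<in> U\<close> \<open>u' \<in> U\<close> unfolding D_def by blast
  qed
  have D_0: "0 \<in> D"
  proof -
    obtain u where "u \<in> U"
      using U(2) by blast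
    moreover have "0 = - u + u"
      by simp
    ultimately show ?thesis
      unfolding D_def by blast
  qed
  define c where "c = enn2real (emeasure \<nu> P)"
  have c: "emeasure \<nu> P = ennreal c" "c \<ge> 0"
    using H.emeasure_compact_finite[OF P] by (auto simp: c_def)
  have "emeasure \<nu> {h \<in> H. emeasure \<mu> U < 2 * G.occupancy U E (h + g)} \<le> ennreal ((2 * c / m + 1) * v)"
    if E: "E \<in> sets \<mu>" and v: "v \<ge> 0" "emeasure \<mu> E \<le> ennreal v" for E v g
  proof -
    define X where "X = {h \<in> H. emeasure \<mu> U < 2 * G.occupancy U E (h + g)}"
    define separated where
      "separated F \<longleftrightarrow> finite F \<and> F \<subseteq> X \<and> (\<forall>h\<in>F. \<forall>k\<in>F. h \<noteq> k \<longrightarrow> h - k \<notin> D)" for F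
    define A where "A h = E \<inter> (\<lambda>u. u + (h + g)) ` U" for h
    have card_le: "real (card F) * m \<le> 2 * v" if F: "separated F" for F
    proof -
      have disj: "disjoint_family_on A F"
        unfolding disjoint_family_on_def
      proof (intro ballI impI)
        fix h k assume hk: "h \<in> F" "k \<in> F" "h \<noteq> k"
        show "A h \<inter> A k = {}"
        proof (rule ccontr)
          assume "A h \<inter> A k \<noteq> {}"
          then obtain u u' where u: "u \<in> U" "u' \<in> U" "u + (h + g) = u' + (k + g)"
            unfolding A_def by auto
          then have "u + h = u' + k"
            by (simp add: add.assoc[symmetric])
          then have "h = - u + (u' + k)"
            by (metis minus_add_cancel)
          then have "h - k = - u + u'"
            by (simp add: add.assoc[symmetric])
          then have "h - k \<in> D"
            using u unfolding D_def by blast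
          then show False
            using F hk by (auto simp: separated_def)
        qed
      qed
      have "ennreal (real (card F)) * ennreal m = (\<Sum>h\<in>F. emeasure \<mu> U)"
        by (simp add: m(1) ennreal_of_nat_eq_real_of_nat)
      also have "\<dots> \<le> (\<Sum>h\<in>F. 2 * emeasure \<mu> (A h))"
      proof (rule sum_mono)
        fix h assume "h \<in> F"
        then have "emeasure \<mu> U < 2 * G.occupancy U E (h + g)"
          using F by (auto simp: separated_def X_def)
        then show "emeasure \<mu> U \<le> 2 * emeasure \<mu> (A h)"
          unfolding A_def occupancy_eq[OF Us E] by simp
      qed
      also have "\<dots> = 2 * emeasure \<mu> (\<Union>h\<in>F. A h)"
        using F disj occupancy_eq(2)[OF Us E]
        by (subst sum_emeasure[symmetric]) (auto simp: sum_distrib_left A_def separated_def)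
      also have "\<dots> \<le> 2 * emeasure \<mu> E"
        using E by (intro mult_left_mono emeasure_mono) (auto simp: A_def)
      also have "\<dots> \<le> 2 * ennreal v"
        by (intro mult_left_mono v) simp
      finally have "ennreal (real (card F) * m) \<le> ennreal (2 * v)"
        using m(2) v(1) by (simp add: ennreal_mult)
      then show ?thesis
        using v(1) by (simp add: ennreal_le_iff)
    qed
    have "card F < Suc (nat \<lceil>2 * v / m\<rceil>)" if "separated F" for F
    proof -
      have "real (card F) \<le> 2 * v / m"
        using card_le[OF that] m(2) by (simp add: pos_le_divide_eq)
      then show ?thesis
        by linarith
    qed
    moreover have "separated {}"
      by (simp add: separated_def)
    ultimately obtain F where F: "separated F" "\<And>F'. separated F' \<Longrightarrow> card F' \<le> card F"
      using ex_has_greatest_nat[of separated "{}" card "Suc (nat \<lceil>2 * v / m\<rceil>)"] by metis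
    have Fs: "finite F" "F \<subseteq> H"
      using F(1) by (auto simp: separated_def X_def)
    have cover: "X \<subseteq> (\<Union>h\<in>F. (\<lambda>x. x + h) ` P)"
    proof
      fix x assume x: "x \<in> X"
      then have xH: "x \<in> H" by (simp add: X_def)
      have "\<exists>h\<in>F. x - h \<in> D"
      proof (rule ccontr)
        assume *: "\<not> ?thesis"
        then have xF: "x \<notin> F"
          using D_0 by force
        have "h - x \<notin> D" if "h \<in> F" for h
          using D_uminus[of "h - x"] * that by auto
        then have "separated (insert x F)"
          using F(1) * x by (auto simp: separated_def)
        then show False
          using F(2)[of "insert x F"] xF Fs by simp
      qed
      then obtain h where h: "h \<in> F" "x - h \<in> D" by blast
      moreover have "x - h \<in> H"
        using H.add_in[OF xH H.uminus_in[of h]] h Fs by auto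
      ultimately have "x = (x - h) + h" "x - h \<in> P"
        by (simp_all add: P_def)
      then show "x \<in> (\<Union>h\<in>F. (\<lambda>x. x + h) ` P)"
        using h(1) by blast
    qed
    have Ps: "P \<in> sets \<nu>"
      by (rule H.compact_in_sets[OF P])
    have Pt: "(\<lambda>x. x + h) ` P \<in> sets \<nu>" if "h \<in> F" for h
    proof (rule H.compact_in_sets)
      show "compact ((\<lambda>x. x + h) ` P)"
        by (intro compact_continuous_image continuous_on_translate_right P)
      show "(\<lambda>x. x + h) ` P \<subseteq> H"
        using P Fs that H.add_in by auto
    qed
    have "emeasure \<nu> X \<le> emeasure \<nu> (\<Union>h\<in>F. (\<lambda>x. x + h) ` P)"
      using Pt Fs by (intro emeasure_mono cover) auto
    also have "\<dots> \<le> (\<Sum>h\<in>F. emeasure \<nu> ((\<lambda>x. x + h) ` P))"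
      using Pt Fs by (intro emeasure_subadditive_finite) auto
    also have "\<dots> = (\<Sum>h\<in>F. ennreal c)"
      using Fs by (intro sum.cong refl) (auto simp: H.emeasure_right_translation[OF _ Ps] c)
    also have "\<dots> = ennreal (real (card F) * c)"
      using c by (simp add: ennreal_of_nat_eq_real_of_nat ennreal_mult)
    also have "real (card F) * c \<le> (2 * v / m) * c"
      using card_le[OF F(1)] m(2) c(2) by (intro mult_right_mono) (simp_all add: pos_le_divide_eq)
    also have "(2 * v / m) * c \<le> (2 * c / m + 1) * v"
      using v(1) by (simp add: field_simps)
    finally show ?thesis
      unfolding X_def by (auto simp: ennreal_leI)
  qed
  moreover have "2 * c / m + 1 > 0"
    using c m by (intro add_nonneg_pos) auto
  ultimately show ?thesis
    by blast
qed

section \<open>Comparison of the isoperimetric profiles\<close>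

text \<open>Split \<open>f\<close> into its thick part \<open>g1\<close> and its thin part \<open>g2\<close>. Slices of \<open>g1\<close> have supports of measure
  \<open>O(v)\<close>, so \<open>coset_comparison\<close> applies to \<open>g1\<close>; cutting off \<open>g2\<close> costs at most the norm of \<open>g2\<close>
  in the gradient, which is again bounded by the gradient of \<open>f\<close>.\<close>

lemma isop_profile_comparison:
  assumes p: "1 \<le> p"
  shows "isop_profile \<mu> S p \<preceq> isop_profile \<nu> T p"
proof -
  obtain n where n: "emeasure \<mu> (set_power S n) > 0"
    by (rule G.ball_positive_measure)
  define U where "U = set_power S n"
  have U: "compact U" "U \<noteq> {}" "emeasure \<mu> U > 0"
    using n G.compact_set_power_T by (auto simp: U_def)
  have Us: "U \<in> sets \<mu>"
    using G.compact_in_sets U(1) by auto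
  obtain C1 where C1: "C1 > 0" and comp: "\<And>f k. f \<in> borel_measurable baire \<Longrightarrow> Lp_norm \<mu> p f < \<infinity> \<Longrightarrow>
    (\<And>g. Lp_norm \<nu> p (slice f g) < \<infinity> \<Longrightarrow> Lp_norm \<nu> p (slice f g) \<le> k * gradient \<nu> T p (slice f g)) \<Longrightarrow>
    Lp_norm \<mu> p f \<le> ennreal C1 * k * gradient \<mu> S p f"
    using coset_comparison[OF p] by blast
  obtain C2 where C2: "C2 > 0" and thin: "\<And>f. f \<in> borel_measurable baire \<Longrightarrow>
    Lp_norm \<mu> p (\<lambda>x. if 2 * G.occupancy U {x. f x \<noteq> 0} x \<le> emeasure \<mu> U then f x else 0)
      \<le> ennreal C2 * gradient \<mu> S p f"
    using G.thin_part_le_gradient[OF p U_def U(3)] by blast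
  obtain C3 where C3: "C3 > 0" and pack: "\<And>E v g. E \<in> sets \<mu> \<Longrightarrow> v \<ge> 0 \<Longrightarrow> emeasure \<mu> E \<le> ennreal v \<Longrightarrow>
    emeasure \<nu> {h \<in> H. emeasure \<mu> U < 2 * G.occupancy U E (h + g)} \<le> ennreal (C3 * v)"
    using thick_slice_measure_le[OF U] by blast
  obtain v0 where v0: "\<And>v. v \<ge> v0 \<Longrightarrow> 1 \<le> 8 * isop_profile \<nu> T p v"
    using H.isop_profile_lower_bound[OF p] by blast
  \<comment> \<open>\<open>4 * (1 + 8 * C2)\<close> bounds the gradient of the thick part, \<open>8 * C2\<close> comes from \<open>1 \<le> 8 * k\<close>\<close>
  define M where "M = 4 * (C1 * (4 * (1 + 8 * C2)) + 8 * C2)"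
  have M: "M > 0"
    using C1 C2 by (simp add: M_def add_pos_pos)
  have "isop_profile \<mu> S p v \<le> ennreal M * isop_profile \<nu> T p (C3 * v)" if v: "v \<ge> 0" "C3 * v \<ge> v0" for v
  proof (cases "isop_profile \<nu> T p (C3 * v) < \<infinity>")
    case False
    then show ?thesis
      using M by (simp add: less_top[symmetric] ennreal_mult_top)
  next
    case kfin: True
    define k where "k = isop_profile \<nu> T p (C3 * v)"
    have k1: "1 \<le> 8 * k"
      unfolding k_def by (rule v0[OF v(2)])
    show ?thesis
      unfolding isop_profile_def[of \<mu>] k_def[symmetric]
    proof (rule SUP_least, rule isop_J_leI)
      fix A f
      assume "A \<in> {A \<in> sets \<mu>. emeasure \<mu> A \<le> ennreal v}"
        and f: "f \<in> borel_measurable \<mu>" "Lp_norm \<mu> p f < \<infinity>" "AE x in \<mu>. x \<notin> A \<longrightarrow> f x = 0"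
      then have A: "A \<in> sets \<mu>" "emeasure \<mu> A \<le> ennreal v" by auto
      obtain g where g: "g \<in> borel_measurable baire" "AE x in \<mu>. f x = g x"
        by (rule G.borel_fun_baire_version[OF f(1)])
      note [measurable] = g(1) G.baire_measurable[OF g(1)]
      have normg: "Lp_norm \<mu> p f = Lp_norm \<mu> p g"
        by (rule Lp_norm_cong_AE[OF f(1) G.baire_measurable[OF g(1)] p g(2)])
      have gradg: "gradient \<mu> S p f = gradient \<mu> S p g"
        by (rule G.gradient_cong_AE[OF f(1) G.baire_measurable[OF g(1)] p g(2)])
      define E where "E = {x. g x \<noteq> 0}"
      have E: "E \<in> sets baire"
        unfolding E_def using measurable_sets[OF g(1), of "- {0}"] by (simp add: vimage_def)
      then have E\<mu>: "E \<in> sets \<mu>"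
        using sets_baire_subset by (simp add: G.sets_borel)
      have "emeasure \<mu> E \<le> emeasure \<mu> A"
      proof (rule emeasure_mono_AE[OF _ A(1)])
        show "AE x in \<mu>. x \<in> E \<longrightarrow> x \<in> A"
          using f(3) g(2) by eventually_elim (auto simp: E_def)
      qed
      then have Ev: "emeasure \<mu> E \<le> ennreal v"
        using A(2) by (rule order_trans)
      define thick where "thick = {x. emeasure \<mu> U < 2 * G.occupancy U E x}"
      note [measurable] = G.occupancy_measurable[OF Us E]
      have thick [measurable]: "thick \<in> sets baire"
      proof -
        have "{x \<in> space baire. emeasure \<mu> U < 2 * G.occupancy U E x} \<in> sets baire"
          by measurable
        then show ?thesis
          by (simp add: thick_def)
      qed
      define g1 where "g1 x = (if x \<in> thick then g x else 0)" for x
      define g2 where "g2 x = (if 2 * G.occupancy U E x \<le> emeasure \<mu> U then g x else 0)" for x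
      have g12: "g1 = (\<lambda>x. g x - g2 x)" "g = (\<lambda>x. g1 x + g2 x)"
        by (auto simp: g1_def g2_def thick_def fun_eq_iff not_le not_less)
      have g1m: "g1 \<in> borel_measurable baire" and g2m: "g2 \<in> borel_measurable baire"
        unfolding g1_def g2_def by measurable
      note [measurable] = G.baire_measurable[OF g1m] G.baire_measurable[OF g2m]
      let ?grad = "gradient \<mu> S p g"
      have n2: "Lp_norm \<mu> p g2 \<le> ennreal C2 * ?grad"
        using thin[OF g(1)] unfolding g2_def E_def .
      have "Lp_norm \<mu> p g1 \<le> ennreal C1 * k * gradient \<mu> S p g1"
      proof (rule comp[OF g1m])
        have "Lp_norm \<mu> p g1 \<le> Lp_norm \<mu> p g"
          by (intro Lp_norm_mono_AE p AE_I2) (auto simp: g1_def)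
        then show "Lp_norm \<mu> p g1 < \<infinity>"
          using f(2) normg by simp
        fix y assume fin: "Lp_norm \<nu> p (slice g1 y) < \<infinity>"
        define X where "X = {h \<in> H. emeasure \<mu> U < 2 * G.occupancy U E (h + y)}"
        have "X = (\<lambda>h. h + y) -` thick \<inter> space \<nu>"
          by (auto simp: X_def thick_def)
        also have "\<dots> \<in> sets \<nu>"
          by (rule measurable_sets[OF H.measurable_right_translation]) (rule sets_baire_subset[OF thick])
        finally have X: "X \<in> sets \<nu>" .
        show "Lp_norm \<nu> p (slice g1 y) \<le> k * gradient \<nu> T p (slice g1 y)"
        proof (rule H.Lp_norm_le_isop_J[OF slice_measurable[OF g1m] p fin, of X])
          show "AE x in \<nu>. x \<notin> X \<longrightarrow> slice g1 y x = 0"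
            by (rule AE_I2) (auto simp: X_def slice_def g1_def thick_def)
          show "isop_J \<nu> T p X \<le> k"
            unfolding k_def isop_profile_def
            using X pack[OF E\<mu> v(1) Ev, of y] by (intro SUP_upper) (simp add: X_def)
          show "k < \<infinity>"
            using kfin by (simp add: k_def)
        qed
      qed
      also have "\<dots> \<le> ennreal C1 * k * (4 * (?grad + 8 * (ennreal C2 * ?grad)))"
      proof (rule mult_left_mono)
        have "gradient \<mu> S p g1 \<le> 4 * (?grad + gradient \<mu> S p g2)"
          unfolding g12(1) by (rule G.gradient_add_le) (auto intro: p)
        also have "\<dots> \<le> 4 * (?grad + 8 * Lp_norm \<mu> p g2)"
          by (intro mult_left_mono add_left_mono G.gradient_le p) auto
        also have "\<dots> \<le> 4 * (?grad + 8 * (ennreal C2 * ?grad))"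
          by (intro mult_left_mono add_left_mono n2) auto
        finally show "gradient \<mu> S p g1 \<le> 4 * (?grad + 8 * (ennreal C2 * ?grad))" .
      qed simp
      also have "\<dots> = ennreal (C1 * (4 * (1 + 8 * C2))) * (k * ?grad)"
        using C1 C2 by (simp add: ennreal_mult distrib_left distrib_right ac_simps)
      finally have n1: "Lp_norm \<mu> p g1 \<le> ennreal (C1 * (4 * (1 + 8 * C2))) * (k * ?grad)" .
      have "ennreal C2 * ?grad * 1 \<le> ennreal C2 * ?grad * (8 * k)"
        by (intro mult_left_mono k1) simp
      then have n2': "Lp_norm \<mu> p g2 \<le> ennreal (8 * C2) * (k * ?grad)"
        using n2 C2 by (auto simp: ennreal_mult ac_simps)
      have "Lp_norm \<mu> p g \<le> 4 * (Lp_norm \<mu> p g1 + Lp_norm \<mu> p g2)"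
        by (subst g12(2)) (intro Lp_norm_add_le p; measurable)
      also have "\<dots> \<le> 4 * (ennreal (C1 * (4 * (1 + 8 * C2))) * (k * ?grad) + ennreal (8 * C2) * (k * ?grad))"
        by (intro mult_left_mono add_mono n1 n2') simp
      also have "\<dots> = 4 * (ennreal (C1 * (4 * (1 + 8 * C2))) + ennreal (8 * C2)) * (k * ?grad)"
        by (simp add: distrib_right mult.assoc)
      also have "4 * (ennreal (C1 * (4 * (1 + 8 * C2))) + ennreal (8 * C2)) = ennreal M"
      proof -
        have "ennreal M = ennreal 4 * ennreal (C1 * (4 * (1 + 8 * C2)) + 8 * C2)"
          unfolding M_def using C1 C2 by (intro ennreal_mult) auto
        also have "ennreal (C1 * (4 * (1 + 8 * C2)) + 8 * C2) = ennreal (C1 * (4 * (1 + 8 * C2))) + ennreal (8 * C2)"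
          using C1 C2 by (intro ennreal_plus) auto
        finally show ?thesis by simp
      qed
      also have "\<dots> * (k * ?grad) = ennreal M * k * ?grad"
        by (simp add: mult.assoc)
      finally show "Lp_norm \<mu> p f \<le> ennreal M * k * gradient \<mu> S p f"
        by (simp add: normg gradg)
    qed
  qed
  moreover have "\<forall>\<^sub>F v in at_top. v \<ge> 0 \<and> C3 * v \<ge> v0"
    using eventually_ge_at_top[of "max 0 (v0 / C3)"]
    by eventually_elim (use C3 in \<open>auto simp: pos_divide_le_eq mult.commute\<close>)
  ultimately have "\<forall>\<^sub>F v in at_top. isop_profile \<mu> S p v \<le> ennreal M * isop_profile \<nu> T p (C3 * v)"
    by (auto elim: eventually_mono)
  then show ?thesis
    unfolding asymp_le_def using C3 M by blast
qed

lemma word_ball_diff: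
  assumes "x \<in> word_ball UNIV S r" "y \<in> word_ball UNIV S r"
  shows "x - y \<in> word_ball UNIV S (2 * r)"
proof -
  obtain m n where mn: "real m \<le> r" "x \<in> set_power S m" "real n \<le> r" "y \<in> set_power S n"
    using assms by (auto simp: word_ball_eq[OF G.Union_set_power])
  have "x + - y \<in> set_power S (m + n)"
    by (intro set_power_add set_power_uminus G.uminus_S mn)
  then show ?thesis
    using mn by (auto simp: word_ball_eq[OF G.Union_set_power] intro!: exI[of _ "m + n"])
qed

lemma undistorted_ball:
  assumes "undistorted H T S"
  obtains L where "L > 0" "\<And>h r. r \<ge> 1 \<Longrightarrow> h \<in> H \<Longrightarrow> h \<in> word_ball UNIV S r \<Longrightarrow> h \<in> word_ball H T (L * r)"
proof -
  obtain L c where L: "L \<ge> 1" "c \<ge> 0" "\<And>x y. x \<in> H \<Longrightarrow> y \<in> H \<Longrightarrow> word_dist T x y / L - c \<le> word_dist S x y"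
    using assms unfolding undistorted_def quasi_isometric_embedding_def by blast
  show ?thesis
  proof
    show "L * (1 + c) > 0"
      using L by simp
    fix h and r :: real assume r: "r \<ge> 1" and h: "h \<in> H" "h \<in> word_ball UNIV S r"
    have "word_dist T 0 h / L \<le> r + c"
      using L(3)[OF H.zero_in h(1)] h(2) by (simp add: word_ball_def)
    also have "\<dots> \<le> r + c * r"
      using mult_left_mono[OF r L(2)] by simp
    finally have "word_dist T 0 h \<le> L * (1 + c) * r"
      using L(1) by (simp add: pos_divide_le_eq algebra_simps)
    then show "h \<in> word_ball H T (L * (1 + c) * r)"
      using h by (simp add: word_ball_def)
  qed
qed

text \<open>Changing the base point of a coset translates the slice on the right, which commutes with
  \<open>left_translate\<close> and preserves \<open>\<nu>\<close> by unimodularity of \<open>H\<close>.\<close>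

lemma slice_right_translate:
  assumes f: "f \<in> borel_measurable baire" and k: "k \<in> H"
  shows "Lp_norm \<nu> p (slice f (k + g)) = Lp_norm \<nu> p (slice f g)"
    and "gradient \<nu> T p (slice f (k + g)) = gradient \<nu> T p (slice f g)"
proof -
  have *: "Lp_norm \<nu> p (\<lambda>h. F (h + k)) = Lp_norm \<nu> p F" if "F \<in> borel_measurable \<nu>" for F
    by (intro Lp_norm_distr H.measurable_right_translation' H.distr_right_translation that k)
  have eq: "slice f (k + g) = (\<lambda>h. slice f g (h + k))"
    by (simp add: slice_def add.assoc)
  show "Lp_norm \<nu> p (slice f (k + g)) = Lp_norm \<nu> p (slice f g)"
    unfolding eq by (intro * slice_measurable f)
  show "gradient \<nu> T p (slice f (k + g)) = gradient \<nu> T p (slice f g)"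
    unfolding gradient_def
  proof (intro SUP_cong refl)
    fix s assume "s \<in> T"
    then have "s \<in> H"
      using H.T_subset by auto
    then have "(\<lambda>h. slice f g h - left_translate s (slice f g) h) \<in> borel_measurable \<nu>"
      by (intro H.displacement_measurable slice_measurable f)
    from *[OF this]
    show "Lp_norm \<nu> p (\<lambda>x. slice f (k + g) x - left_translate s (slice f (k + g)) x)
      = Lp_norm \<nu> p (\<lambda>x. slice f g x - left_translate s (slice f g) x)"
      unfolding eq by (simp add: left_translate_def add.assoc)
  qed
qed

text \<open>Any two points of a coset in a ball of radius \<open>2 r\<close> differ by an element of \<open>H\<close> of length at most
  \<open>4 r\<close> in \<open>G\<close>, hence of length \<open>O(r)\<close> in \<open>H\<close>. The first doubling of the radius makes room for a
  Baire set containing the ball, so that the supports of all slices can be controlled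
  everywhere and not only up to null sets.\<close>

lemma isop_profile_balls_comparison:
  assumes p: "1 \<le> p" and und: "undistorted H T S"
  shows "isop_profile_balls UNIV \<mu> S p \<preceq> isop_profile_balls H \<nu> T p"
proof -
  obtain C1 where C1: "C1 > 0" and comp: "\<And>f k. f \<in> borel_measurable baire \<Longrightarrow> Lp_norm \<mu> p f < \<infinity> \<Longrightarrow>
    (\<And>g. Lp_norm \<nu> p (slice f g) < \<infinity> \<Longrightarrow> Lp_norm \<nu> p (slice f g) \<le> k * gradient \<nu> T p (slice f g)) \<Longrightarrow>
    Lp_norm \<mu> p f \<le> ennreal C1 * k * gradient \<mu> S p f"
    using coset_comparison[OF p] by blast
  obtain L where L: "L > 0" "\<And>h r. r \<ge> 1 \<Longrightarrow> h \<in> H \<Longrightarrow> h \<in> word_ball UNIV S r \<Longrightarrow> h \<in> word_ball H T (L * r)"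
    by (rule undistorted_ball[OF und]) blast
  obtain O' n where O': "open O'" "0 \<in> O'" "O' \<subseteq> set_power S n"
    by (rule G.ball_contains_neighbourhood)
  have "isop_profile_balls UNIV \<mu> S p r \<le> ennreal C1 * isop_profile_balls H \<nu> T p (4 * L * r)"
    if r: "r \<ge> 1" "r \<ge> real n" for r
  proof (cases "isop_profile_balls H \<nu> T p (4 * L * r) < \<infinity>")
    case False
    then show ?thesis
      using C1 by (simp add: less_top[symmetric] ennreal_mult_top)
  next
    case kfin: True
    define k where "k = isop_profile_balls H \<nu> T p (4 * L * r)"
    show ?thesis
      unfolding isop_profile_balls_def[of UNIV] k_def[symmetric]
    proof (rule isop_J_leI)
      fix f
      assume f: "f \<in> borel_measurable \<mu>" "Lp_norm \<mu> p f < \<infinity>" "AE x in \<mu>. x \<notin> word_ball UNIV S r \<longrightarrow> f x = 0"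
      define W where "W = (\<Union>b\<in>word_ball UNIV S r. (\<lambda>x. b + x) ` O')"
      have "{n. real n \<le> r} \<subseteq> {..nat \<lfloor>r\<rfloor>}"
        by (auto simp: le_nat_floor)
      then have "finite {n. real n \<le> r}"
        by (rule finite_subset) simp
      then have ball: "compact (word_ball UNIV S r)"
        unfolding word_ball_eq[OF G.Union_set_power] by (intro compact_UN G.compact_set_power_T) auto
      have W: "open W" "word_ball UNIV S r \<subseteq> W"
        unfolding W_def using O'(2) by (auto intro!: open_translate_left O'(1)) force
      have W_ball: "W \<subseteq> word_ball UNIV S (2 * r)"
      proof
        fix x assume "x \<in> W"
        then obtain b y where bw: "b \<in> word_ball UNIV S r" "y \<in> O'" "x = b + y"
          by (auto simp: W_def)
        have "- y \<in> set_power S n"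
          using bw(2) O'(3) by (intro set_power_uminus G.uminus_S) auto
        then have "- y \<in> word_ball UNIV S r"
          using r(2) by (auto simp: word_ball_eq[OF G.Union_set_power])
        from word_ball_diff[OF bw(1) this] show "x \<in> word_ball UNIV S (2 * r)"
          by (simp add: bw(3))
      qed
      obtain B K where B: "B \<in> sets baire" "open B" "word_ball UNIV S r \<subseteq> B" "B \<subseteq> W" "B \<subseteq> K" "compact K"
        by (rule G.baire_between[OF ball W])
      obtain f' where f': "f' \<in> borel_measurable baire" "AE x in \<mu>. f x = f' x"
        by (rule G.borel_fun_baire_version[OF f(1)])
      note [measurable] = B(1) f'(1)
      define g where "g x = (if x \<in> B then f' x else 0)" for x
      have gm: "g \<in> borel_measurable baire"
        unfolding g_def by measurable
      have "AE x in \<mu>. f x = g x"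
        using f(3) f'(2) by eventually_elim (use B(3) in \<open>auto simp: g_def\<close>)
      then have norms: "Lp_norm \<mu> p f = Lp_norm \<mu> p g" "gradient \<mu> S p f = gradient \<mu> S p g"
        using G.baire_measurable[OF gm] f(1) p by (auto intro!: Lp_norm_cong_AE G.gradient_cong_AE)
      have "Lp_norm \<mu> p g \<le> ennreal C1 * k * gradient \<mu> S p g"
      proof (rule comp[OF gm])
        show "Lp_norm \<mu> p g < \<infinity>"
          using f(2) norms by simp
        fix y assume fin: "Lp_norm \<nu> p (slice g y) < \<infinity>"
        show "Lp_norm \<nu> p (slice g y) \<le> k * gradient \<nu> T p (slice g y)"
        proof (cases "\<exists>h\<in>H. g (h + y) \<noteq> 0")
          case False
          then have "Lp_norm \<nu> p (slice g y) = Lp_norm \<nu> p (\<lambda>x. 0)"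
            by (intro Lp_norm_cong_AE slice_measurable gm p AE_I2) (auto simp: slice_def)
          then show ?thesis
            by (simp add: Lp_norm_zero[OF p])
        next
          case True
          then obtain h where h: "h \<in> H" "g (h + y) \<noteq> 0" by blast
          have hy: "h + y \<in> word_ball UNIV S (2 * r)"
            using h(2) B(4) W_ball by (auto simp: g_def split: if_splits)
          have "Lp_norm \<nu> p (slice g (h + y)) \<le> k * gradient \<nu> T p (slice g (h + y))"
          proof (rule H.Lp_norm_le_isop_J[OF slice_measurable[OF gm] p, of _ "word_ball H T (4 * L * r)"])
            show "Lp_norm \<nu> p (slice g (h + y)) < \<infinity>"
              using fin by (simp add: slice_right_translate[OF gm h(1)])
            show "AE x in \<nu>. x \<notin> word_ball H T (4 * L * r) \<longrightarrow> slice g (h + y) x = 0"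
            proof (intro AE_I2 impI, rule ccontr)
              fix x assume x: "x \<in> space \<nu>" "x \<notin> word_ball H T (4 * L * r)" "slice g (h + y) x \<noteq> 0"
              have "x + (h + y) \<in> word_ball UNIV S (2 * r)"
                using x(3) B(4) W_ball by (auto simp: slice_def g_def split: if_splits)
              from word_ball_diff[OF this hy] have "x \<in> word_ball UNIV S (4 * r)"
                by simp
              then have "x \<in> word_ball H T (L * (4 * r))"
                using x(1) r(1) by (intro L(2)) auto
              then show False
                using x(2) by (simp add: ac_simps)
            qed
            show "isop_J \<nu> T p (word_ball H T (4 * L * r)) \<le> k"
              by (simp add: k_def isop_profile_balls_def)
            show "k < \<infinity>"
              using kfin by (simp add: k_def)
          qed
          then show ?thesis
            by (simp add: slice_right_translate[OF gm h(1)])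
        qed
      qed
      then show "Lp_norm \<mu> p f \<le> ennreal C1 * k * gradient \<mu> S p f"
        by (simp add: norms)
    qed
  qed
  moreover have "\<forall>\<^sub>F r in at_top. r \<ge> 1 \<and> r \<ge> real n"
    using eventually_ge_at_top[of 1] eventually_ge_at_top[of "real n"] by eventually_elim auto
  ultimately have "\<forall>\<^sub>F r in at_top. isop_profile_balls UNIV \<mu> S p r
      \<le> ennreal C1 * isop_profile_balls H \<nu> T p (4 * L * r)"
    by (auto elim: eventually_mono)
  then show ?thesis
    unfolding asymp_le_def using C1 L(1) by (intro exI[of _ "4 * L"]) auto
qed

end

theorem theorem2:
  fixes H S T :: "'a::{topological_group_add, t2_space} set"
    and \<mu> \<nu> :: "'a measure"
    and p :: ennreal
  assumes "locally_compact_space (euclidean :: 'a topology)"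
    and "compact_symmetric_generating UNIV S"
    and "left_haar_measure UNIV \<mu>"
    and "unimodular (UNIV :: 'a set)"
    and "is_subgroup H" and "closed H"
    and "compact_symmetric_generating H T"
    and "left_haar_measure H \<nu>"
    and "unimodular H"
    and "1 \<le> p"
  shows "isop_profile \<mu> S p \<preceq> isop_profile \<nu> T p \<and>
    (undistorted H T S \<longrightarrow> isop_profile_balls UNIV \<mu> S p \<preceq> isop_profile_balls H \<nu> T p)"
proof -
  interpret unimodular_pair S H T \<mu> \<nu>
    by unfold_locales (use assms in \<open>auto simp: is_subgroup_def\<close>)
  show ?thesis
    using isop_profile_comparison isop_profile_balls_comparison assms(10) by blast
qed

end
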